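(* Let $K_{11},K_{22},K_{33},K_{24}$ be real constants with $K_{22}>0$, and set $k_1=K_{11}/K_{22}$, $k_3=K_{33}/K_{22}$, $k_{24}=K_{24}/K_{22}$. Assume $k_1\geq1$, $k_3\geq1$ and $k_{24}>1$. Let $\mathscr{B}$ be the circular cylinder of radius $R>0$ and height $L>0$, with cylindrical coordinates $(r,\vartheta,z)$ about its axis and orthonormal frame $(\bm e_r,\bm e_\vartheta,\bm e_z)$, and let $\rho=r/R\in[0,1]$. Let $$\beta_{\mathrm{ET}}(\rho)=\arctan\left(\frac{2\sqrt{k_{24}(k_{24}-1)}\,\rho}{\sqrt{k_3}\,[k_{24}-(k_{24}-1)\rho^2]}\right),$$ let $\beta$ be either $\beta_{\mathrm{ET}}$ or $-\beta_{\mathrm{ET}}$, and let $\bm n_{\mathrm{ET}}=\sin\beta(\rho)\,\bm e_\vartheta+\cos\beta(\rho)\,\bm e_z$ be the corresponding escaped-twist director field on $\mathscr{B}$. Then $\bm n_{\mathrm{ET}}$ is locally stable in the following sense: for all absolutely continuous functions $f,g:[0,1]\to\mathbb{R}$ with $f(0)=g(0)=0$ and $f(1)=0$ (and $g(1)$ arbitrary), not both identically zero, the perturbation $$\bm v=f(\rho)\,\bm e_r-g(\rho)\cos\beta(\rho)\,\bm e_\vartheta+g(\rho)\sin\beta(\rho)\,\bm e_z$$ satisfies $$\delta^2\mathscr{F}_{\mathrm F}(\bm n_{\mathrm{ET}})[\bm v]>0,$$ where $\delta^2\mathscr{F}_{\mathrm F}(\bm n)[\bm v]$ is the second variation of Frank's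 elastic free energy (written out explicitly in the context), whose value here may be $+\infty$.
   Context: Frank's elastic free energy of a unit vector field (director field) $\bm n$ on $\mathscr{B}$ is $\mathscr{F}_{\mathrm F}[\bm n]=\int_{\mathscr{B}}W_{\mathrm F}\,dV$ with $$W_{\mathrm F}=\tfrac12K_{11}(\operatorname{div}\bm n)^2+\tfrac12K_{22}(\bm n\cdot\operatorname{curl}\bm n)^2+\tfrac12K_{33}|\bm n\times\operatorname{curl}\bm n|^2+K_{24}\left[\operatorname{tr}(\nabla\bm n)^2-(\operatorname{div}\bm n)^2\right].$$ The fields $\bm n_{\mathrm{ET}}$ are equilibria of $\mathscr{F}_{\mathrm F}$ among cylindrically symmetric fields $\sin\beta(r)\bm e_\vartheta+\cos\beta(r)\bm e_z$ with $\beta(0)=0$, which are tangent to the lateral boundary (degenerate planar anchoring); $f(1)=0$ expresses that perturbations respect this anchoring to first order. The second variation at an equilibrium field $\bm n$ is the quadratic functional of $\bm v$ (with $\bm v\cdot\bm n=0$, $v^2=\bm v\cdot\bm v$) equal to $\frac{d^2}{dt^2}\mathscr{F}_{\mathrm F}[\bm n_t]|_{t=0}$ for paths of unit fields $\bm n_t$ with $\bm n_0=\bm n$, $\dot{\bm n}_t|_{t=0}=\bm v$, $\ddot{\bm n}_t|_{t=0}=-v^2\bm n$. Explicitly, $$\begin{aligned} \delta^2\mathscr{F}_{\mathrm F}(\bm n)[\bm v]=\int_{\mathscr{B}}\Big\{&(K_{11}-2K_{24})\left[(\operatorname{div}\bm v)^2-v^2(\operatorname{div}\bm n)^2-(\operatorname{div}\bm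 n)\,\bm n\cdot\nabla v^2\right]\\ &+K_{22}\left[(\bm v\cdot\operatorname{curl}\bm n+\bm n\cdot\operatorname{curl}\bm v)^2+2(\bm n\cdot\operatorname{curl}\bm n)(\bm v\cdot\operatorname{curl}\bm v-v^2\,\bm n\cdot\operatorname{curl}\bm n)\right]\\ &+K_{33}\left[|\bm v\times\operatorname{curl}\bm n+\bm n\times\operatorname{curl}\bm v|^2+(\bm n\times\operatorname{curl}\bm n)\cdot(2\bm v\times\operatorname{curl}\bm v-2v^2\,\bm n\times\operatorname{curl}\bm n-\nabla v^2)\right]\\ &+2K_{24}\left[\operatorname{tr}(\nabla\bm v)^2-v^2\operatorname{tr}(\nabla\bm n)^2+(\bm n\times\operatorname{curl}\bm n)\cdot\nabla v^2\right]\Big\}\,dV. \end{aligned}$$ Here $(\nabla\bm u)_{ij}=\partial_ju_i$ in Cartesian components, $\operatorname{tr}(\nabla\bm u)^2$ is the trace of the matrix square of $\nabla\bm u$, and derivatives of $f,g$ are the almost-everywhere derivatives. For $f,g$ as in the claim the negative part of the integrand is integrable, so the integral is well defined in $(-\infty,+\infty]$. *)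

theory Defs
  imports "HOL-Analysis.Analysis"
begin

unbundle cross3_syntax

section \<open>Absolutely continuous functions of one real variable\<close>

text \<open>The usual epsilon-delta condition over finite families of non-overlapping
  subintervals. (The library constant \<^const>\<open>absolutely_continuous\<close> is about measures.)\<close>

definition abs_cont_on :: "real set \<Rightarrow> (real \<Rightarrow> real) \<Rightarrow> bool" where
  "abs_cont_on S f \<longleftrightarrow>
     (\<forall>\<epsilon>>0. \<exists>\<delta>>0. \<forall>P :: (real \<times> real) set.
        finite P \<and> (\<forall>(a, b)\<in>P. a < b \<and> {a..b} \<subseteq> S) \<and>
        disjoint_family_on (\<lambda>(a, b). {a<..<b}) P \<and> (\<Sum>(a, b)\<in>P. b - a) < \<delta>
        \<longrightarrow> (\<Sum>(a, b)\<in>P. \<bar>f b - f a\<bar>) < \<epsilon>)"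


section \<open>Integrals with values in the extended reals\<close>

text \<open>On type \<^typ>\<open>ereal\<close>, \<open>\<infinity> - \<infinity> = \<infinity>\<close>, so \<open>ext_integral M F\<close> is meaningful only when
  one of the two parts is finite; \<open>quasi_integrable M F\<close> says that it is well defined
  in \<open>(-\<infinity>, \<infinity>]\<close>.\<close>

definition quasi_integrable :: "'a measure \<Rightarrow> ('a \<Rightarrow> real) \<Rightarrow> bool" where
  "quasi_integrable M F \<longleftrightarrow>
     F \<in> borel_measurable M \<and> (\<integral>\<^sup>+ x. ennreal (- F x) \<partial>M) < \<infinity>"

definition ext_integral :: "'a measure \<Rightarrow> ('a \<Rightarrow> real) \<Rightarrow> ereal" where
  "ext_integral M F =
     enn2ereal (\<integral>\<^sup>+ x. ennreal (F x) \<partial>M) - enn2ereal (\<integral>\<^sup>+ x. ennreal (- F x) \<partial>M)"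


section \<open>Differential operators in Cartesian components\<close>

text \<open>\<open>Jac u x $ i $ j\<close> is \<open>\<partial>\<^sub>j u\<^sub>i\<close>. At a point where the field is not
  differentiable all of these operators have unspecified values.\<close>

abbreviation Jac :: "(real^3 \<Rightarrow> real^3) \<Rightarrow> real^3 \<Rightarrow> real^3^3" where
  "Jac u x \<equiv> jacobian u (at x)"

definition divg :: "(real^3 \<Rightarrow> real^3) \<Rightarrow> real^3 \<Rightarrow> real" where
  "divg u x = trace (Jac u x)"

definition curl :: "(real^3 \<Rightarrow> real^3) \<Rightarrow> real^3 \<Rightarrow> real^3" where
  "curl u x = vector [Jac u x $ 3 $ 2 - Jac u x $ 2 $ 3,
                      Jac u x $ 1 $ 3 - Jac u x $ 3 $ 1,
                      Jac u x $ 2 $ 1 - Jac u x $ 1 $ 2]"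

definition tr_sq :: "(real^3 \<Rightarrow> real^3) \<Rightarrow> real^3 \<Rightarrow> real" where
  "tr_sq u x = trace (Jac u x ** Jac u x)"

definition grad :: "(real^3 \<Rightarrow> real) \<Rightarrow> real^3 \<Rightarrow> real^3" where
  "grad \<phi> x = (\<chi> j. frechet_derivative \<phi> (at x) (axis j 1))"


section \<open>Second variation of Frank's elastic free energy\<close>

definition second_var_density ::
  "real \<Rightarrow> real \<Rightarrow> real \<Rightarrow> real \<Rightarrow> (real^3 \<Rightarrow> real^3) \<Rightarrow> (real^3 \<Rightarrow> real^3) \<Rightarrow> real^3 \<Rightarrow> real" where
  "second_var_density K11 K22 K33 K24 n v x =
    (let N = n x; V = v x; v2 = V \<bullet> V;
         cn = curl n x; cv = curl v x; dv2 = grad (\<lambda>y. v y \<bullet> v y) x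
     in (K11 - 2 * K24) *
          ((divg v x)\<^sup>2 - v2 * (divg n x)\<^sup>2 - divg n x * (N \<bullet> dv2))
      + K22 *
          ((V \<bullet> cn + N \<bullet> cv)\<^sup>2 + 2 * (N \<bullet> cn) * (V \<bullet> cv - v2 * (N \<bullet> cn)))
      + K33 *
          ((norm ((V \<times> cn) + (N \<times> cv)))\<^sup>2
           + (N \<times> cn) \<bullet> (2 *\<^sub>R (V \<times> cv) - (2 * v2) *\<^sub>R (N \<times> cn) - dv2))
      + 2 * K24 *
          (tr_sq v x - v2 * tr_sq n x + (N \<times> cn) \<bullet> dv2))"

definition second_variation ::
  "real \<Rightarrow> real \<Rightarrow> real \<Rightarrow> real \<Rightarrow> (real^3) set
    \<Rightarrow> (real^3 \<Rightarrow> real^3) \<Rightarrow> (real^3 \<Rightarrow> real^3) \<Rightarrow> ereal" where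
  "second_variation K11 K22 K33 K24 B n v =
     ext_integral (lebesgue_on B) (second_var_density K11 K22 K33 K24 n v)"


section \<open>The cylinder and fields on it\<close>

definition cylinder :: "real \<Rightarrow> real \<Rightarrow> (real^3) set" where
  "cylinder R L = {x. (x$1)\<^sup>2 + (x$2)\<^sup>2 \<le> R\<^sup>2 \<and> 0 \<le> x$3 \<and> x$3 \<le> L}"

definition rad :: "real^3 \<Rightarrow> real" where
  "rad x = sqrt ((x$1)\<^sup>2 + (x$2)\<^sup>2)"

text \<open>On the axis, where \<open>rad x = 0\<close>, the first two frame vectors are \<open>0\<close>.\<close>

definition e_r :: "real^3 \<Rightarrow> real^3" where
  "e_r x = vector [x$1 / rad x, x$2 / rad x, 0]"

definition e_theta :: "real^3 \<Rightarrow> real^3" where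
  "e_theta x = vector [- (x$2) / rad x, x$1 / rad x, 0]"

definition e_z :: "real^3" where
  "e_z = vector [0, 0, 1]"

definition beta_ET :: "real \<Rightarrow> real \<Rightarrow> real \<Rightarrow> real" where
  "beta_ET k3 k24 \<rho> =
     arctan (2 * sqrt (k24 * (k24 - 1)) * \<rho> / (sqrt k3 * (k24 - (k24 - 1) * \<rho>\<^sup>2)))"

text \<open>In the next two definitions \<open>\<beta>\<close>, \<open>f\<close>, \<open>g\<close> are functions of the scaled radius
  \<open>rad x / R\<close>; on the cylinder only their values on \<open>{0..1}\<close> matter.\<close>

definition twist_field :: "real \<Rightarrow> (real \<Rightarrow> real) \<Rightarrow> real^3 \<Rightarrow> real^3" where
  "twist_field R \<beta> x =
     (let \<rho> = rad x / R in sin (\<beta> \<rho>) *\<^sub>R e_theta x + cos (\<beta> \<rho>) *\<^sub>R e_z)"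

definition perturbation ::
  "real \<Rightarrow> (real \<Rightarrow> real) \<Rightarrow> (real \<Rightarrow> real) \<Rightarrow> (real \<Rightarrow> real) \<Rightarrow> real^3 \<Rightarrow> real^3" where
  "perturbation R \<beta> f g x =
     (let \<rho> = rad x / R
      in f \<rho> *\<^sub>R e_r x - (g \<rho> * cos (\<beta> \<rho>)) *\<^sub>R e_theta x + (g \<rho> * sin (\<beta> \<rho>)) *\<^sub>R e_z)"

end

theory Submission
  imports Defs
begin

text \<open>All fields depend on \<open>\<rho>\<close> only. With \<open>D = \<rho> d/d\<rho>\<close>, \<open>s = sin \<beta>\<close>, \<open>c = cos \<beta>\<close> and
  \<open>w = (k24 + (k24 - 1) \<rho>\<^sup>2) / (k24 - (k24 - 1) \<rho>\<^sup>2)\<close>, the escaped twist satisfies \<open>D \<beta> = w s c\<close>,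
  \<open>D w = w\<^sup>2 - 1\<close> and \<open>k3 s\<^sup>2 = (w\<^sup>2 - 1) c\<^sup>2\<close>. In the second variation \<open>f\<close> and \<open>g\<close> decouple. The field
  \<open>w s c = D \<beta>\<close> is a positive Jacobi field for the \<open>g\<close>-part, and \<open>s\<close> is one for the \<open>f\<close>-part when
  \<open>k1 = k3 = 1\<close> (and a subsolution in general). Hence the density times \<open>r\<^sup>2\<close> is
  \<open>K22\<close> times a sum of squares such as \<open>(D f - w c\<^sup>2 f)\<^sup>2\<close>, \<open>(D g - (2 w c\<^sup>2 - 1/w) g)\<^sup>2\<close> and of
  nonnegative multiples of \<open>(D f + f)\<^sup>2\<close> and \<open>f\<^sup>2\<close>, plus the exact
  derivative \<open>D (A f\<^sup>2 + B g\<^sup>2)\<close>. The exact part integrates to \<open>B(1) g(1)\<^sup>2\<close> with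
  \<open>B(1) = w(1) - 1/w(1) > 0\<close>. If everything vanishes, then \<open>f/s\<close> and \<open>g/(w s c)\<close> are constant
  and zero at \<open>\<rho> = 1\<close>. That absolutely continuous functions are almost everywhere differentiable
  and satisfy the fundamental theorem of calculus is proved from the Vitali covering theorem and a
  Henstock gauge.\<close>

section \<open>Variation of absolutely continuous functions\<close>

text \<open>The two Jacobi fields come from symmetries. \<open>w s c\<close> is the velocity of the
  dilated profiles \<beta>(\<lambda>\<rho>): the equilibrium equation is autonomous in log \<rho>,
  so every dilated profile solves it too. \<open>s\<close> comes from turning the directors alone
  about the axis, which moves the field along \<open>e_r\<close> with amplitude \<open>s\<close>;
  the one-constant energy is unchanged by this up to a divergence term. The K24 terms are exact
  derivatives, -2 k24 D(c^2 f^2) and -2 k24 D((c^2 - s^2) g^2), so \<open>k24\<close> acts only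
  through the profile and the boundary.

  The obstacle is the axis. Substituting f = s \<phi> would bring in 1/s, which is singular at
  \<rho> = 0. The squares therefore use only the regular factors D s / s = w c^2 and its analogue
  for \<open>g\<close>. Then A and B are continuously differentiable on all of [0,1], and A f^2 + B
  g^2 is absolutely continuous up to the axis, so no cut-off is needed. The squares divided by
  \<rho> may have an infinite integral; only the exact part is integrable from the outset, which is
  why positivity is argued in the extended reals.\<close>

lemma sum_increments_le_mono_on:
  fixes G :: "real \<Rightarrow> real"
  assumes "finite P" "mono_on {a..b} G" "a \<le> b"
    and "\<And>u v. (u, v) \<in> P \<Longrightarrow> a \<le> u \<and> u < v \<and> v \<le> b"
    and "pairwise (\<lambda>i j. disjnt {fst i..snd i} {fst j..snd j}) P"
  shows "(\<Sum>i\<in>P. G (snd i) - G (fst i)) \<le> G b - G a"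
  using assms
\<comment> \<open>Intervals are added in order of their left ends. Disjointness puts all earlier
  ones inside \<open>{a..u}\<close>, so the induction hypothesis is needed with \<open>u\<close> in
  place of \<open>b\<close>; monotonicity absorbs the gaps.\<close>
proof (induction P arbitrary: b rule: finite_ranking_induct[where f = fst])
  case empty
  then show ?case using mono_onD[of "{a..b}" G a b] by simp
next
  case (insert x P)
  obtain u v where x: "x = (u, v)" by (cases x)
  have uv: "a \<le> u" "u < v" "v \<le> b" using insert(6)[of u v] x by auto
  show ?case
  proof (cases "x \<in> P")
    case True
    then show ?thesis using insert(3)[of b] insert(4-7) by (simp add: insert_absorb)
  next
    case False
    have before: "a \<le> u' \<and> u' < v' \<and> v' \<le> u" if "(u', v') \<in> P" for u' v'
    proof -
      have "a \<le> u'" "u' < v'" using insert(6)[of u' v'] that by auto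
      moreover have "u' \<le> u" using insert(2)[OF that] x by simp
      moreover have "disjnt {u..v} {u'..v'}"
        using pairwiseD[OF insert(7), of "(u, v)" "(u', v')"] that False x by auto
      then have "u \<notin> {u'..v'}" using uv by (auto simp: disjnt_iff)
      ultimately show ?thesis using uv by auto
    qed
    have "(\<Sum>i\<in>P. G (snd i) - G (fst i)) \<le> G u - G a"
    proof (rule insert(3))
      show "mono_on {a..u} G" using insert(4) uv by (auto intro: mono_on_subset)
      show "pairwise (\<lambda>i j. disjnt {fst i..snd i} {fst j..snd j}) P"
        using insert(7) by (auto simp: pairwise_def)
    qed (use uv before in auto)
    moreover have "G v \<le> G b" using mono_onD[OF insert(4), of v b] uv by simp
    ultimately show ?thesis using False insert(1) x by (simp add: sum.insert_if)
  qed
qed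

text \<open>Vitali's theorem selects countably many disjoint intervals that miss only a null part of
  \<open>S\<close>. Each is no longer than its \<open>G\<close>-increment over \<open>e\<close>, and
  increments over disjoint intervals add up to at most \<open>G b - G a\<close>. The bound is put on
  a superset \<open>T\<close> because \<open>S\<close> is not known to be measurable.\<close>

lemma Vitali_mono_on_measure_bound:
  fixes G :: "real \<Rightarrow> real"
  assumes G: "mono_on {a..b} G" and "a \<le> b" "e > 0"
    and S: "\<And>x d. x \<in> S \<Longrightarrow> d > 0 \<Longrightarrow> \<exists>u v. a \<le> u \<and> u < v \<and> v \<le> b \<and> u \<le> x \<and> x \<le> v
              \<and> v - u < d \<and> e * (v - u) \<le> G v - G u"
  obtains T where "S \<subseteq> T" "T \<in> lmeasurable" "measure lebesgue T \<le> (G b - G a) / e"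
proof -
  define K where "K = {(u, v). a \<le> u \<and> u < v \<and> v \<le> b \<and> e * (v - u) \<le> G v - G u}"
  define m where "m = (\<lambda>i::real \<times> real. (fst i + snd i) / 2)"
  define r where "r = (\<lambda>i::real \<times> real. (snd i - fst i) / 2)"
  have cb: "cball (m i) (r i) = {fst i..snd i}" for i
    by (auto simp: m_def r_def cball_eq_atLeastAtMost field_simps)
  have r: "0 < r i" if "i \<in> K" for i using that by (auto simp: K_def r_def)
  have cov: "\<exists>i. i \<in> K \<and> x \<in> cball (m i) (r i) \<and> r i < d" if x: "x \<in> S" and d: "0 < d" for x d
  proof -
    obtain u v where uv: "a \<le> u" "u < v" "v \<le> b" "u \<le> x" "x \<le> v" "v - u < d" "e * (v - u) \<le> G v - G u"
      using S[OF x d] by blast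
    then have "(u, v) \<in> K \<and> x \<in> cball (m (u, v)) (r (u, v)) \<and> r (u, v) < d"
      unfolding cb by (auto simp: K_def r_def)
    then show ?thesis by blast
  qed
  obtain C where C: "countable C" "C \<subseteq> K"
     "pairwise (\<lambda>i j. disjnt (cball (m i) (r i)) (cball (m j) (r j))) C"
     "negligible (S - (\<Union>i \<in> C. cball (m i) (r i)))"
    by (rule Vitali_covering_theorem_cballs[of K r S m, OF r cov])
  have nonneg: "0 \<le> (G b - G a) / e"
    using mono_onD[OF G, of a b] assms(2,3) by simp
  have fin: "measure lebesgue (\<Union>i\<in>D. {fst i..snd i}) \<le> (G b - G a) / e"
    if D: "D \<subseteq> C" "finite D" for D
  proof -
    have "measure lebesgue (\<Union>i\<in>D. {fst i..snd i}) \<le> (\<Sum>i\<in>D. measure lebesgue {fst i..snd i})"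
      using D by (intro measure_UNION_le) auto
    also have "\<dots> = (\<Sum>i\<in>D. snd i - fst i)"
      using D C(2) by (intro sum.cong) (auto simp: K_def dest!: subsetD)
    also have "\<dots> \<le> (\<Sum>i\<in>D. (G (snd i) - G (fst i)) / e)"
      using D C(2) \<open>e > 0\<close> by (intro sum_mono) (auto simp: K_def field_simps dest!: subsetD)
    also have "\<dots> = (\<Sum>i\<in>D. G (snd i) - G (fst i)) / e" by (simp add: sum_divide_distrib)
    also have "\<dots> \<le> (G b - G a) / e"
    proof (intro divide_right_mono sum_increments_le_mono_on)
      show "pairwise (\<lambda>i j. disjnt {fst i..snd i} {fst j..snd j}) D"
        using C(3) D(1) unfolding cb by (rule pairwise_subset)
      show "\<And>u v. (u, v) \<in> D \<Longrightarrow> a \<le> u \<and> u < v \<and> v \<le> b"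
        using D C(2) by (auto simp: K_def)
    qed (use D assms in auto)
    finally show ?thesis .
  qed
  let ?U = "\<Union>i\<in>C. {fst i..snd i}"
  have U: "?U \<in> lmeasurable" "measure lebesgue ?U \<le> (G b - G a) / e"
    using fmeasurable_UN_bound[OF C(1), of "\<lambda>i. {fst i..snd i}" lebesgue "(G b - G a) / e"]
      measure_UN_bound[OF C(1), of "\<lambda>i. {fst i..snd i}" lebesgue "(G b - G a) / e"] fin nonneg
    by auto
  have neg: "negligible (S - ?U)" using C(4) unfolding cb .
  show thesis
  proof
    show "S \<subseteq> ?U \<union> (S - ?U)" by auto
    show "?U \<union> (S - ?U) \<in> lmeasurable" by (intro fmeasurable.Un U(1) negligible_imp_measurable neg)
    have "measure lebesgue (?U \<union> (S - ?U)) \<le> measure lebesgue ?U + measure lebesgue (S - ?U)"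
      by (intro measure_Un_le fmeasurableD U(1) negligible_imp_measurable neg)
    then show "measure lebesgue (?U \<union> (S - ?U)) \<le> (G b - G a) / e"
      using U(2) negligible_imp_measure0[OF neg] by linarith
  qed
qed

text \<open>Partitions grow by one piece on the right, so that rule induction is induction over
  partitions without lists of points. Empty pieces are allowed.\<close>

inductive var_sum :: "(real \<Rightarrow> real) \<Rightarrow> real \<Rightarrow> real \<Rightarrow> real \<Rightarrow> bool" for f a where
  base: "var_sum f a a 0"
| step: "var_sum f a x s \<Longrightarrow> x \<le> y \<Longrightarrow> var_sum f a y (s + \<bar>f y - f x\<bar>)"

lemma var_sum_le: "var_sum f a x s \<Longrightarrow> a \<le> x"
  by (induction rule: var_sum.induct) auto

lemma var_sum_single: "a \<le> x \<Longrightarrow> var_sum f a x \<bar>f x - f a\<bar>"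
  using var_sum.step[OF var_sum.base, of a x f] by simp

text \<open>Links partitions to the interval families in \<open>abs_cont_on\<close>. Empty pieces
  are dropped, since those families ask for \<open>a < b\<close>.\<close>

lemma var_sum_intervals:
  assumes "var_sum f a x s"
  shows "\<exists>P. finite P \<and> (\<forall>(u, v)\<in>P. a \<le> u \<and> u < v \<and> v \<le> x) \<and>
     disjoint_family_on (\<lambda>(u, v). {u<..<v}) P \<and> (\<Sum>(u, v)\<in>P. v - u) \<le> x - a \<and>
     (\<Sum>(u, v)\<in>P. \<bar>f v - f u\<bar>) = s"
  using assms
proof (induction rule: var_sum.induct)
  case base
  then show ?case by (intro exI[of _ "{}"]) (auto simp: disjoint_family_on_def)
next
  case (step x s y)
  then obtain P where P: "finite P" "\<forall>(u, v)\<in>P. a \<le> u \<and> u < v \<and> v \<le> x"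
    "disjoint_family_on (\<lambda>(u, v). {u<..<v}) P" "(\<Sum>(u, v)\<in>P. v - u) \<le> x - a"
     "(\<Sum>(u, v)\<in>P. \<bar>f v - f u\<bar>) = s" by blast
  have ax: "a \<le> x" using step(1) by (rule var_sum_le)
  show ?case
  proof (cases "x = y")
    case True
    then show ?thesis using P by (intro exI[of _ P]) auto
  next
    case False
    then have notin: "(x, y) \<notin> P" using P(2) step(2) by fastforce
    have "disjoint_family_on (\<lambda>(u, v). {u<..<v}) (insert (x, y) P)"
      using P(2,3) unfolding disjoint_family_on_insert[OF notin] by fastforce
    then show ?thesis
      using P(1,2,4,5) step(2) False ax notin
      by (intro exI[of _ "insert (x, y) P"]) (auto dest!: bspec)
  qed
qed

text \<open>By the triangle inequality, inserting \<open>c\<close> as a further partition point can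
  only enlarge the sum.\<close>

lemma var_sum_split:
  assumes "var_sum f a x s" "a \<le> c" "c \<le> x"
  shows "\<exists>s1 s2. var_sum f a c s1 \<and> var_sum f c x s2 \<and> s \<le> s1 + s2"
  using assms
proof (induction rule: var_sum.induct)
  case base
  then have "c = a" by simp
  then show ?case using var_sum.base[of f a] by force
next
  case (step x s y)
  show ?case
  proof (cases "c \<le> x")
    case True
    then obtain s1 s2 where "var_sum f a c s1" "var_sum f c x s2" "s \<le> s1 + s2"
      using step by blast
    then show ?thesis using var_sum.step[of f c x s2 y] step(2) by fastforce
  next
    case False
    then have "var_sum f a c (s + \<bar>f c - f x\<bar>)" "var_sum f c y \<bar>f y - f c\<bar>"
      using var_sum.step[OF step(1), of c] var_sum_single step by auto
    then show ?thesis by (intro exI[of _ "s + \<bar>f c - f x\<bar>"] exI[of _ "\<bar>f y - f c\<bar>"]) auto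
  qed
qed

text \<open>Absolute continuity with \<epsilon> = 1 bounds the sums over intervals shorter than some
  \<open>d\<close>, and \<open>{a..b}\<close> is exhausted by finitely many pieces of length
  \<open>d / 2\<close>.\<close>

lemma abs_cont_on_var_sum_bounded:
  assumes "abs_cont_on {a..b} f"
  obtains M where "\<And>x s. var_sum f a x s \<Longrightarrow> x \<le> b \<Longrightarrow> s \<le> M"
proof -
  obtain d where d: "d > 0" and ac: "\<And>P. finite P \<Longrightarrow> (\<forall>(u, v)\<in>P. u < v \<and> {u..v} \<subseteq> {a..b}) \<Longrightarrow>
        disjoint_family_on (\<lambda>(a, b). {a<..<b}) P \<Longrightarrow> (\<Sum>(a, b)\<in>P. b - a) < d
        \<Longrightarrow> (\<Sum>(a, b)\<in>P. \<bar>f b - f a\<bar>) < 1"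
    using assms[unfolded abs_cont_on_def, rule_format, of 1] by auto
  have short: "s \<le> 1" if vs: "var_sum f c x s" and cx: "a \<le> c" "x \<le> b" "x - c < d" for c x s
  proof -
    obtain P where P: "finite P" "\<forall>(u, v)\<in>P. c \<le> u \<and> u < v \<and> v \<le> x"
      "disjoint_family_on (\<lambda>(u, v). {u<..<v}) P" "(\<Sum>(u, v)\<in>P. v - u) \<le> x - c"
      "(\<Sum>(u, v)\<in>P. \<bar>f v - f u\<bar>) = s"
      using var_sum_intervals[OF vs] by blast
    have "(\<Sum>(u, v)\<in>P. \<bar>f v - f u\<bar>) < 1"
    proof (rule ac)
      show "\<forall>(u, v)\<in>P. u < v \<and> {u..v} \<subseteq> {a..b}" using P(2) cx by fastforce
    qed (use P cx in auto)
    then show ?thesis using P by simp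
  qed
  \<comment> \<open>Each step peels off a left piece of length \<open>d / 2\<close>, strictly
    shorter than \<open>d\<close> as \<open>short\<close> requires, at a cost of at most 1.\<close>
  have bound: "s \<le> n + 1" if "var_sum f c x s" "a \<le> c" "x \<le> b" "x - c \<le> real n * (d / 2)" for n c x s
    using that
  proof (induction n arbitrary: c s)
    case 0
    then show ?case using short[of c x s] d by simp
  next
    case (Suc n)
    show ?case
    proof (cases "x - c < d")
      case True
      then show ?thesis using short[of c x s] Suc by simp
    next
      case False
      then obtain s1 s2 where s: "var_sum f c (c + d/2) s1" "var_sum f (c + d/2) x s2" "s \<le> s1 + s2"
        using var_sum_split[OF Suc(2), of "c + d/2"] d by auto
      have "s1 \<le> 1" using short[OF s(1)] Suc False d by simp
      moreover have "s2 \<le> n + 1" using Suc(1)[OF s(2)] Suc(3-5) d by (simp add: field_simps)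
      ultimately show ?thesis using s by simp
    qed
  qed
  obtain n where n: "(b - a) / (d/2) \<le> real n" using real_arch_simple by blast
  show thesis
  proof
    show "s \<le> n + 1" if "var_sum f a x s" "x \<le> b" for x s
      using bound[OF that(1) order_refl that(2), of n] n d that by (auto simp: field_simps)
  qed
qed

text \<open>A real-valued \<open>Sup\<close>, so it is meaningful only where the sums are bounded,
  as they are for absolutely continuous \<open>f\<close>.\<close>

definition total_variation :: "(real \<Rightarrow> real) \<Rightarrow> real \<Rightarrow> real \<Rightarrow> real" where
  "total_variation f a x = Sup {s. var_sum f a x s}"

text \<open>Any partition of \<open>{a..x}\<close> extends by the single piece from \<open>x\<close>
  to \<open>y\<close>. The resulting second claim makes both \<open>V - f\<close> and
  \<open>V + f\<close> nondecreasing, where \<open>V\<close> is the total variation.\<close>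

lemma abs_cont_on_total_variation:
  assumes f: "abs_cont_on {a..b} f"
  shows "var_sum f a x s \<Longrightarrow> x \<le> b \<Longrightarrow> s \<le> total_variation f a x"
    and "a \<le> x \<Longrightarrow> x \<le> y \<Longrightarrow> y \<le> b \<Longrightarrow> \<bar>f y - f x\<bar> \<le> total_variation f a y - total_variation f a x"
proof -
  obtain M where M: "\<And>x s. var_sum f a x s \<Longrightarrow> x \<le> b \<Longrightarrow> s \<le> M"
    using abs_cont_on_var_sum_bounded[OF f] by blast
  have upper: "s \<le> total_variation f a x" if "var_sum f a x s" "x \<le> b" for x s
    unfolding total_variation_def using that M by (intro cSup_upper bdd_aboveI[of _ M]) auto
  show "var_sum f a x s \<Longrightarrow> x \<le> b \<Longrightarrow> s \<le> total_variation f a x" by (rule upper)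
  assume xy: "a \<le> x" "x \<le> y" "y \<le> b"
  have "total_variation f a x \<le> total_variation f a y - \<bar>f y - f x\<bar>"
    unfolding total_variation_def[of f a x]
  proof (rule cSup_least)
    show "{s. var_sum f a x s} \<noteq> {}" using var_sum_single[OF xy(1)] by auto
    show "s \<le> total_variation f a y - \<bar>f y - f x\<bar>" if "s \<in> {s. var_sum f a x s}" for s
      using upper[OF var_sum.step, of x s y] that xy by simp
  qed
  then show "\<bar>f y - f x\<bar> \<le> total_variation f a y - total_variation f a x" by simp
qed

section \<open>Closure properties of absolute continuity\<close>

lemma abs_cont_onE:
  assumes "abs_cont_on S f" "e > 0"
  obtains d where "d > 0"
    "\<And>P. finite P \<Longrightarrow> \<forall>(u, v)\<in>P. u < v \<and> {u..v} \<subseteq> S \<Longrightarrow>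
       disjoint_family_on (\<lambda>(u, v). {u<..<v}) P \<Longrightarrow> (\<Sum>(u, v)\<in>P. v - u) < d \<Longrightarrow>
       (\<Sum>(u, v)\<in>P. \<bar>f v - f u\<bar>) < e"
  using assms unfolding abs_cont_on_def by meson

lemma abs_cont_onI:
  assumes "\<And>e. e > 0 \<Longrightarrow> \<exists>d>0. \<forall>P. finite P \<longrightarrow> (\<forall>(u, v)\<in>P. u < v \<and> {u..v} \<subseteq> S) \<longrightarrow>
       disjoint_family_on (\<lambda>(u, v). {u<..<v}) P \<longrightarrow> (\<Sum>(u, v)\<in>P. v - u) < d \<longrightarrow>
       (\<Sum>(u, v)\<in>P. \<bar>f v - f u\<bar>) < e"
  shows "abs_cont_on S f"
  unfolding abs_cont_on_def imp_conjL by (intro allI impI assms)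

text \<open>A common source for sums, products and Lipschitz functions; the summand
  \<open>v - u\<close> provides the Lipschitz case.\<close>

lemma abs_cont_on_if_increments_le:
  assumes f: "abs_cont_on S f" and g: "abs_cont_on S g" and "C \<ge> 0"
    and h: "\<And>u v. u < v \<Longrightarrow> {u..v} \<subseteq> S \<Longrightarrow> \<bar>h v - h u\<bar> \<le> C * (\<bar>f v - f u\<bar> + \<bar>g v - g u\<bar> + (v - u))"
  shows "abs_cont_on S h"
proof (rule abs_cont_onI)
  fix e :: real assume "e > 0"
  \<comment> \<open>Three sums of size at most \<open>e'\<close> get multiplied by \<open>C\<close>;
    using \<open>C + 1\<close> keeps the denominator positive when \<open>C = 0\<close>.\<close>
  define e' where "e' = e / (3 * (C + 1))"
  have e': "e' > 0" using \<open>e > 0\<close> \<open>C \<ge> 0\<close> by (simp add: e'_def)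
  obtain d1 where d1: "d1 > 0" "\<And>P. finite P \<Longrightarrow> \<forall>(u, v)\<in>P. u < v \<and> {u..v} \<subseteq> S \<Longrightarrow>
       disjoint_family_on (\<lambda>(u, v). {u<..<v}) P \<Longrightarrow> (\<Sum>(u, v)\<in>P. v - u) < d1 \<Longrightarrow>
       (\<Sum>(u, v)\<in>P. \<bar>f v - f u\<bar>) < e'"
    using abs_cont_onE[OF f e'] by blast
  obtain d2 where d2: "d2 > 0" "\<And>P. finite P \<Longrightarrow> \<forall>(u, v)\<in>P. u < v \<and> {u..v} \<subseteq> S \<Longrightarrow>
       disjoint_family_on (\<lambda>(u, v). {u<..<v}) P \<Longrightarrow> (\<Sum>(u, v)\<in>P. v - u) < d2 \<Longrightarrow>
       (\<Sum>(u, v)\<in>P. \<bar>g v - g u\<bar>) < e'"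
    using abs_cont_onE[OF g e'] by blast
  have "(\<Sum>(a, b)\<in>P. \<bar>h b - h a\<bar>) < e"
    if P: "finite P" "\<forall>(a, b)\<in>P. a < b \<and> {a..b} \<subseteq> S" "disjoint_family_on (\<lambda>(a, b). {a<..<b}) P"
      "(\<Sum>(a, b)\<in>P. b - a) < min (min d1 d2) e'" for P
  proof -
    have "(\<Sum>(a, b)\<in>P. \<bar>h b - h a\<bar>) \<le>
        (\<Sum>(a, b)\<in>P. C * (\<bar>f b - f a\<bar> + \<bar>g b - g a\<bar> + (b - a)))"
      using P(2) h by (intro sum_mono) fastforce
    also have "\<dots> = C * ((\<Sum>(a, b)\<in>P. \<bar>f b - f a\<bar>) + (\<Sum>(a, b)\<in>P. \<bar>g b - g a\<bar>) + (\<Sum>(a, b)\<in>P. b - a))"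
      by (simp only: case_prod_unfold sum_distrib_left[symmetric] sum.distrib[symmetric])
    also have "\<dots> \<le> C * (e' + e' + e')"
      using d1(2)[OF P(1-3)] d2(2)[OF P(1-3)] P(4) \<open>C \<ge> 0\<close> by (intro mult_left_mono) auto
    also have "\<dots> < (C + 1) * (e' + e' + e')" using e' by simp
    also have "\<dots> = 3 * (C + 1) * e'" by (simp add: algebra_simps)
    also have "\<dots> = e" using \<open>C \<ge> 0\<close> by (simp add: e'_def)
    finally show ?thesis .
  qed
  moreover have "min (min d1 d2) e' > 0" using d1 d2 e' by simp
  ultimately show "\<exists>d>0. \<forall>P. finite P \<longrightarrow> (\<forall>(u, v)\<in>P. u < v \<and> {u..v} \<subseteq> S) \<longrightarrow>
       disjoint_family_on (\<lambda>(u, v). {u<..<v}) P \<longrightarrow> (\<Sum>(u, v)\<in>P. v - u) < d \<longrightarrow>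
       (\<Sum>(u, v)\<in>P. \<bar>h v - h u\<bar>) < e"
    by (intro exI[of _ "min (min d1 d2) e'"] conjI allI impI)
qed

lemma abs_cont_on_const: "abs_cont_on S (\<lambda>x. c)"
  by (rule abs_cont_onI) (auto intro!: exI[of _ 1])

lemma abs_cont_on_lipschitz:
  assumes "\<And>u v. u < v \<Longrightarrow> {u..v} \<subseteq> S \<Longrightarrow> \<bar>h v - h u\<bar> \<le> C * (v - u)"
  shows "abs_cont_on S h"
proof (rule abs_cont_on_if_increments_le[OF abs_cont_on_const[of S 0] abs_cont_on_const[of S 0]])
  show "\<bar>h v - h u\<bar> \<le> \<bar>C\<bar> * (\<bar>0 - 0\<bar> + \<bar>0 - 0\<bar> + (v - u))" if "u < v" "{u..v} \<subseteq> S" for u v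
  proof -
    have "C * (v - u) \<le> \<bar>C\<bar> * (v - u)" using that by (intro mult_right_mono) auto
    then show ?thesis using assms[OF that] by simp
  qed
qed simp

lemma abs_cont_on_add:
  assumes "abs_cont_on S f" "abs_cont_on S g"
  shows "abs_cont_on S (\<lambda>x. f x + g x)"
  by (rule abs_cont_on_if_increments_le[OF assms, of 1]) (auto simp: abs_if)

lemma abs_cont_on_subset:
  assumes f: "abs_cont_on S f" and T: "T \<subseteq> S"
  shows "abs_cont_on T f"
proof (rule abs_cont_onI)
  fix e :: real assume "e > 0"
  obtain d where d: "d > 0" "\<And>P. finite P \<Longrightarrow> \<forall>(u, v)\<in>P. u < v \<and> {u..v} \<subseteq> S \<Longrightarrow>
       disjoint_family_on (\<lambda>(u, v). {u<..<v}) P \<Longrightarrow> (\<Sum>(u, v)\<in>P. v - u) < d \<Longrightarrow>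
       (\<Sum>(u, v)\<in>P. \<bar>f v - f u\<bar>) < e"
    using abs_cont_onE[OF f \<open>e > 0\<close>] by blast
  have "\<forall>(u, v)\<in>P. u < v \<and> {u..v} \<subseteq> S" if "\<forall>(u, v)\<in>P. u < v \<and> {u..v} \<subseteq> T" for P
    using that T by blast
  from d(2)[OF _ this] d(1)
  show "\<exists>d>0. \<forall>P. finite P \<longrightarrow> (\<forall>(u, v)\<in>P. u < v \<and> {u..v} \<subseteq> T) \<longrightarrow>
       disjoint_family_on (\<lambda>(u, v). {u<..<v}) P \<longrightarrow> (\<Sum>(u, v)\<in>P. v - u) < d \<longrightarrow>
       (\<Sum>(u, v)\<in>P. \<bar>f v - f u\<bar>) < e"
    by (intro exI[of _ d] conjI allI impI)
qed

lemma abs_cont_on_imp_continuous_on: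
  assumes f: "abs_cont_on {a..b} f"
  shows "continuous_on {a..b} f"
  unfolding continuous_on_iff
proof (intro ballI allI impI)
  fix x e :: real assume x: "x \<in> {a..b}" and "e > 0"
  obtain d where d: "d > 0" "\<And>P. finite P \<Longrightarrow> \<forall>(u, v)\<in>P. u < v \<and> {u..v} \<subseteq> {a..b} \<Longrightarrow>
       disjoint_family_on (\<lambda>(u, v). {u<..<v}) P \<Longrightarrow> (\<Sum>(u, v)\<in>P. v - u) < d \<Longrightarrow>
       (\<Sum>(u, v)\<in>P. \<bar>f v - f u\<bar>) < e"
    using abs_cont_onE[OF f \<open>e > 0\<close>] by blast
  have *: "\<bar>f v - f u\<bar> < e" if "u < v" "u \<in> {a..b}" "v \<in> {a..b}" "v - u < d" for u v
    using d(2)[of "{(u, v)}"] that by (auto simp: disjoint_family_on_def)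
  have "dist (f y) (f x) < e" if "y \<in> {a..b}" "dist y x < d" for y
    using *[of x y] *[of y x] that x \<open>e > 0\<close>
    by (cases y x rule: linorder_cases) (auto simp: dist_real_def abs_minus_commute)
  then show "\<exists>d>0. \<forall>y\<in>{a..b}. dist y x < d \<longrightarrow> dist (f y) (f x) < e"
    using d(1) by blast
qed

lemma abs_cont_on_mult:
  assumes f: "abs_cont_on {a..b} f" and g: "abs_cont_on {a..b} g"
  shows "abs_cont_on {a..b} (\<lambda>x. f x * g x)"
proof -
  have "bounded (f ` {a..b})" "bounded (g ` {a..b})"
    using compact_continuous_image[OF abs_cont_on_imp_continuous_on[OF f]]
      compact_continuous_image[OF abs_cont_on_imp_continuous_on[OF g]] by (auto intro: compact_imp_bounded)
  then obtain M1 M2 where M: "\<And>x. x \<in> {a..b} \<Longrightarrow> \<bar>f x\<bar> \<le> M1" "\<And>x. x \<in> {a..b} \<Longrightarrow> \<bar>g x\<bar> \<le> M2"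
    unfolding bounded_iff by (metis imageI real_norm_def)
  show ?thesis
  proof (rule abs_cont_on_if_increments_le[OF f g])
    fix u v assume uv: "u < v" "{u..v} \<subseteq> {a..b}"
    then have mem: "u \<in> {a..b}" "v \<in> {a..b}" by auto
    have "f v * g v - f u * g u = f v * (g v - g u) + g u * (f v - f u)" by (simp add: algebra_simps)
    then have "\<bar>f v * g v - f u * g u\<bar> \<le> \<bar>f v\<bar> * \<bar>g v - g u\<bar> + \<bar>g u\<bar> * \<bar>f v - f u\<bar>"
      by (metis abs_mult abs_triangle_ineq)
    also have "\<dots> \<le> (\<bar>M1\<bar> + \<bar>M2\<bar>) * \<bar>g v - g u\<bar> + (\<bar>M1\<bar> + \<bar>M2\<bar>) * \<bar>f v - f u\<bar>"
      using M(1)[OF mem(2)] M(2)[OF mem(1)] by (intro add_mono mult_right_mono) auto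
    also have "\<dots> \<le> (\<bar>M1\<bar> + \<bar>M2\<bar>) * (\<bar>f v - f u\<bar> + \<bar>g v - g u\<bar> + (v - u))"
      using mult_nonneg_nonneg[of "\<bar>M1\<bar> + \<bar>M2\<bar>" "v - u"] uv by (simp add: algebra_simps)
    finally show "\<bar>f v * g v - f u * g u\<bar> \<le> (\<bar>M1\<bar> + \<bar>M2\<bar>) * (\<bar>f v - f u\<bar> + \<bar>g v - g u\<bar> + (v - u))" .
  qed simp
qed

lemma abs_cont_on_C1:
  assumes d: "\<And>x. x \<in> {a..b} \<Longrightarrow> (f has_real_derivative f' x) (at x)"
    and c: "continuous_on {a..b} f'"
  shows "abs_cont_on {a..b} f"
proof -
  have "bounded (f' ` {a..b})"
    using compact_continuous_image[OF c] by (auto intro: compact_imp_bounded)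
  then obtain M where M: "\<And>x. x \<in> {a..b} \<Longrightarrow> \<bar>f' x\<bar> \<le> M"
    unfolding bounded_iff by (metis imageI real_norm_def)
  show ?thesis
  proof (rule abs_cont_on_lipschitz)
    fix u v assume uv: "u < v" "{u..v} \<subseteq> {a..b}"
    then obtain z where z: "z > u" "z < v" "f v - f u = (v - u) * f' z"
      using MVT2[of u v f f'] d by (auto simp: subset_iff)
    then have "z \<in> {a..b}" using uv by auto
    then show "\<bar>f v - f u\<bar> \<le> M * (v - u)"
      using z M[of z] uv by (simp add: abs_mult mult.commute mult_right_mono)
  qed
qed

section \<open>Almost everywhere differentiability\<close>

text \<open>The intervals need only contain \<open>x\<close>, not start or end there, which is the
  shape of a Vitali cover. Applied to \<open>- f\<close>, the condition says that \<open>f\<close>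
  has slopes at most \<open>- e\<close> on arbitrarily short intervals around
  \<open>x\<close>.\<close>

definition steep_at :: "(real \<Rightarrow> real) \<Rightarrow> real \<Rightarrow> real \<Rightarrow> bool" where
  "steep_at f e x \<longleftrightarrow>
     (\<forall>d>0. \<exists>u v. u \<le> x \<and> x \<le> v \<and> u < v \<and> v - u < d \<and> e * (v - u) \<le> f v - f u)"

lemma steep_at_within:
  assumes "steep_at f e x" "x \<in> {a<..<b}" "d > 0"
  obtains u v where "a < u" "u \<le> x" "x \<le> v" "v < b" "u < v" "v - u < d" "e * (v - u) \<le> f v - f u"
proof -
  let ?d = "min d (min (x - a) (b - x))"
  have "?d > 0" using assms by auto
  then obtain u v where "u \<le> x" "x \<le> v" "u < v" "v - u < ?d" "e * (v - u) \<le> f v - f u"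
    using assms(1) unfolding steep_at_def by blast
  then show thesis by (intro that[of u v]) auto
qed

lemma frequently_quotient_imp_steep_at:
  assumes "\<exists>\<^sub>F y in at x. (f y - f x) / (y - x) > e"
  shows "steep_at f e x"
  unfolding steep_at_def
proof (intro allI impI)
  fix d :: real assume "d > 0"
  then obtain y where y: "y \<noteq> x" "dist y x < d" "(f y - f x) / (y - x) > e"
    using assms unfolding frequently_at by blast
  show "\<exists>u v. u \<le> x \<and> x \<le> v \<and> u < v \<and> v - u < d \<and> e * (v - u) \<le> f v - f u"
  proof (cases "x < y")
    case True
    then show ?thesis using y by (intro exI[of _ x] exI[of _ y]) (auto simp: dist_real_def field_simps)
  next
    case False
    then show ?thesis using y by (intro exI[of _ y] exI[of _ x]) (auto simp: dist_real_def field_simps)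
  qed
qed

text \<open>Austin's argument: if the variation sum \<open>s\<close> over a partition is close to the total variation \<open>V\<close>, then on every piece of the partition
  the monotone function \<open>V - f\<close> or \<open>V + f\<close> grows by little, yet it is steep wherever \<open>f\<close>
  is steep in the direction opposite to its net increment over the piece.\<close>

lemma negligible_steep_both:
  assumes f: "abs_cont_on {a..b} f" and e: "e > 0"
  shows "negligible {x \<in> {a<..<b}. steep_at f e x \<and> steep_at (\<lambda>x. - f x) e x}"
proof (cases "a \<le> b")
  case True
  define V where "V = total_variation f a"
  define E where "E = (\<lambda>x y. {z \<in> {x<..<y}. steep_at f e z \<and> steep_at (\<lambda>x. - f x) e z})"
  note V = abs_cont_on_total_variation[OF f, folded V_def]
  have oriented: "\<exists>T. E x y \<subseteq> T \<and> T \<in> lmeasurable \<and> measure lebesgue T \<le> (V y - V x - \<bar>f y - f x\<bar>) / e"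
    if xy: "a \<le> x" "x \<le> y" "y \<le> b" and h: "h = f \<or> h = (\<lambda>x. - f x)" "h x \<le> h y" for x y h
  proof -
    have steep: "steep_at (\<lambda>x. - h x) e z" if "z \<in> E x y" for z
      using that h(1) by (auto simp: E_def)
    have incr: "\<bar>h v - h u\<bar> \<le> V v - V u" if "x \<le> u" "u \<le> v" "v \<le> y" for u v
      using V(2)[of u v] that xy h(1) by auto
    have mono: "mono_on {x..y} (\<lambda>z. V z - h z)"
    proof (rule mono_onI)
      show "V u - h u \<le> V v - h v" if "u \<in> {x..y}" "v \<in> {x..y}" "u \<le> v" for u v
        using incr[of u v] that by simp
    qed
    have cov: "\<exists>u v. x \<le> u \<and> u < v \<and> v \<le> y \<and> u \<le> z \<and> z \<le> v \<and> v - u < d \<and>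
        e * (v - u) \<le> (V v - h v) - (V u - h u)" if z: "z \<in> E x y" and "d > 0" for z d
    proof -
      have "z \<in> {x<..<y}" using z by (simp add: E_def)
      then obtain u v where uv: "x < u" "u \<le> z" "z \<le> v" "v < y" "u < v" "v - u < d" "e * (v - u) \<le> - h v - - h u"
        using steep_at_within[OF steep[OF z] _ \<open>d > 0\<close>] by blast
      moreover have "0 \<le> V v - V u" using incr[of u v] uv by linarith
      ultimately show ?thesis by (intro exI[of _ u] exI[of _ v]) linarith
    qed
    obtain T where "E x y \<subseteq> T" "T \<in> lmeasurable" "measure lebesgue T \<le> ((V y - h y) - (V x - h x)) / e"
      by (rule Vitali_mono_on_measure_bound[OF mono xy(2) e cov])
    moreover have "(V y - h y) - (V x - h x) = V y - V x - \<bar>f y - f x\<bar>"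
      using h by auto
    ultimately show ?thesis by auto
  qed
  have piece: "\<exists>T. E x y \<subseteq> T \<and> T \<in> lmeasurable \<and> measure lebesgue T \<le> (V y - V x - \<bar>f y - f x\<bar>) / e"
    if xy: "a \<le> x" "x \<le> y" "y \<le> b" for x y
    using oriented[OF xy, of f] oriented[OF xy, of "\<lambda>x. - f x"] by (cases "f x \<le> f y") auto
  \<comment> \<open>The bounds of the pieces telescope along the partition. The partition points lie
    in no open piece and are added as null sets.\<close>
  have cover: "\<exists>T. E a x \<subseteq> T \<and> T \<in> lmeasurable \<and> measure lebesgue T \<le> (V x - s) / e"
    if "var_sum f a x s" "x \<le> b" for x s
    using that
  proof (induction rule: var_sum.induct)
    case base
    have "0 \<le> V a" using V(1)[OF var_sum.base] base by simp
    then show ?case using e by (intro exI[of _ "{}"]) (auto simp: E_def)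
  next
    case (step x s y)
    have ax: "a \<le> x" using step(1) by (rule var_sum_le)
    obtain T1 where T1: "E a x \<subseteq> T1" "T1 \<in> lmeasurable" "measure lebesgue T1 \<le> (V x - s) / e"
      using step by auto
    obtain T2 where T2: "E x y \<subseteq> T2" "T2 \<in> lmeasurable" "measure lebesgue T2 \<le> (V y - V x - \<bar>f y - f x\<bar>) / e"
      using piece[OF ax step(2) step.prems] by auto
    have lm: "T1 \<union> T2 \<union> {x} \<in> lmeasurable" using T1 T2 negligible_imp_measurable[OF negligible_sing]
      by (intro fmeasurable.Un) auto
    have "measure lebesgue (T1 \<union> T2 \<union> {x}) \<le> measure lebesgue T1 + measure lebesgue T2 + measure lebesgue {x}"
      using measure_Un_le[of "T1 \<union> T2" lebesgue "{x}"] measure_Un_le[of T1 lebesgue T2] T1 T2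
      by (force simp: fmeasurableD)
    also have "\<dots> \<le> (V x - s) / e + (V y - V x - \<bar>f y - f x\<bar>) / e" using T1 T2 by simp
    also have "\<dots> = (V y - (s + \<bar>f y - f x\<bar>)) / e"
      by (simp add: diff_divide_distrib add_divide_distrib)
    finally have "measure lebesgue (T1 \<union> T2 \<union> {x}) \<le> (V y - (s + \<bar>f y - f x\<bar>)) / e" .
    moreover have "E a y \<subseteq> E a x \<union> E x y \<union> {x}" by (auto simp: E_def)
    then have "E a y \<subseteq> T1 \<union> T2 \<union> {x}" using T1(1) T2(1) by blast
    ultimately show ?case using lm by blast
  qed
  have "negligible (E a b)"
    unfolding negligible_outer_le
  proof (intro allI impI)
    fix e' :: real assume "e' > 0"
    \<comment> \<open>A partition sum within \<open>e * e'\<close> of the supremum makes the bound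
      \<open>(V b - s) / e\<close> at most \<open>e'\<close>.\<close>
    have "V b - e * e' < Sup {s. var_sum f a b s}"
      using \<open>e' > 0\<close> e unfolding V_def total_variation_def by simp
    moreover have "{s. var_sum f a b s} \<noteq> {}" using var_sum_single[OF True] by auto
    moreover have "bdd_above {s. var_sum f a b s}" using V(1) by (intro bdd_aboveI[of _ "V b"]) auto
    ultimately obtain s where s: "var_sum f a b s" "V b - e * e' < s"
      by (subst (asm) less_cSup_iff) auto
    obtain T where "E a b \<subseteq> T" "T \<in> lmeasurable" "measure lebesgue T \<le> (V b - s) / e"
      using cover[OF s(1)] by auto
    moreover have "(V b - s) / e \<le> e'" using s(2) e by (simp add: field_simps)
    ultimately show "\<exists>T. E a b \<subseteq> T \<and> T \<in> lmeasurable \<and> measure lebesgue T \<le> e'"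
      by (intro exI[of _ T]) auto
  qed
  then show ?thesis by (simp add: E_def)
qed auto

text \<open>Where \<open>f\<close> or \<open>- f\<close> is steep, so is its total variation, which
  is monotone. The set thus has outer measure at most \<open>(V b - V a) / n\<close> for every
  \<open>n\<close>.\<close>

lemma negligible_steep_unbounded:
  assumes f: "abs_cont_on {a..b} f"
  shows "negligible {x \<in> {a<..<b}. \<forall>n::nat. steep_at f n x \<or> steep_at (\<lambda>x. - f x) n x}" (is "negligible ?E")
proof (cases "a \<le> b")
  case True
  define V where "V = total_variation f a"
  note V = abs_cont_on_total_variation(2)[OF f, folded V_def]
  have mono: "mono_on {a..b} V"
  proof (rule mono_onI)
    show "V u \<le> V v" if "u \<in> {a..b}" "v \<in> {a..b}" "u \<le> v" for u v
      using V[of u v] that by simp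
  qed
  have "V a \<le> V b" using mono True by (auto dest: mono_onD)
  show ?thesis
    unfolding negligible_outer_le
  proof (intro allI impI)
    fix e :: real assume "e > 0"
    obtain n :: nat where n: "(V b - V a) / e < real n" using reals_Archimedean2 by blast
    have n0: "real n > 0" using n \<open>V a \<le> V b\<close> \<open>e > 0\<close> by (smt (verit) divide_nonneg_pos)
    have cov: "\<exists>u v::real. a \<le> u \<and> u < v \<and> v \<le> b \<and> u \<le> x \<and> x \<le> v \<and> v - u < d \<and> n * (v - u) \<le> V v - V u"
      if x: "x \<in> ?E" and "d > 0" for x d :: real
    proof -
      have x': "x \<in> {a<..<b}" using x by simp
      obtain h where h: "h = f \<or> h = (\<lambda>x. - f x)" "steep_at h n x" using x by blast
      obtain u v :: real where uv: "a < u" "u \<le> x" "x \<le> v" "v < b" "u < v" "v - u < d" "n * (v - u) \<le> h v - h u"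
        by (rule steep_at_within[of h "real n" x a b d]) (use h(2) x' \<open>d > 0\<close> in auto)
      moreover have "h v - h u \<le> V v - V u" using V[of u v] uv h(1) by auto
      ultimately show ?thesis by (intro exI[of _ u] exI[of _ v]) linarith
    qed
    obtain T where "?E \<subseteq> T" "T \<in> lmeasurable" "measure lebesgue T \<le> (V b - V a) / n"
      by (rule Vitali_mono_on_measure_bound[OF mono True n0 cov])
    moreover have "(V b - V a) / n \<le> e" using n n0 \<open>e > 0\<close> by (simp add: field_simps)
    ultimately show "\<exists>T. ?E \<subseteq> T \<and> T \<in> lmeasurable \<and> measure lebesgue T \<le> e"
      by (intro exI[of _ T]) auto
  qed
qed auto

text \<open>\<open>bdd\<close> confines the lower and upper limits of the difference quotient to
  [-n, n], and \<open>gap\<close> forbids two rationals strictly between them, so they are equal and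
  finite. Rational pairs suffice and keep the exceptional set a countable union.\<close>

lemma differentiable_if_not_steep:
  assumes gap: "\<And>p q. p \<in> \<rat> \<Longrightarrow> q \<in> \<rat> \<Longrightarrow> p < q \<Longrightarrow> \<not> (steep_at f q x \<and> steep_at (\<lambda>x. - f x) (- p) x)"
    and bdd: "\<not> steep_at f n x" "\<not> steep_at (\<lambda>x. - f x) n x"
  shows "f differentiable (at x)"
proof -
  define Q where "Q = (\<lambda>y. ereal ((f y - f x) / (y - x)))"
  have upper: "steep_at f q x" if "ereal q < Limsup (at x) Q" for q
  proof (rule ccontr)
    assume "\<not> steep_at f q x"
    then have "\<forall>\<^sub>F y in at x. Q y \<le> ereal q"
      using frequently_quotient_imp_steep_at[of q f x] by (auto simp: frequently_def Q_def not_less)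
    then have "Limsup (at x) Q \<le> ereal q" by (rule Limsup_bounded)
    then show False using that by simp
  qed
  have lower: "steep_at (\<lambda>x. - f x) (- p) x" if "Liminf (at x) Q < ereal p" for p
  proof (rule ccontr)
    assume "\<not> steep_at (\<lambda>x. - f x) (- p) x"
    moreover have "((- f y) - (- f x)) / (y - x) = - ((f y - f x) / (y - x))" for y
      by (simp add: diff_divide_distrib)
    ultimately have "\<forall>\<^sub>F y in at x. ereal p \<le> Q y"
      using frequently_quotient_imp_steep_at[of "-p" "\<lambda>x. - f x" x]
      by (auto simp: frequently_def Q_def not_less)
    then have "ereal p \<le> Liminf (at x) Q" by (rule Liminf_bounded)
    then show False using that by simp
  qed
  have le: "Liminf (at x) Q \<le> Limsup (at x) Q" by (rule Liminf_le_Limsup) simp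
  have ub: "Limsup (at x) Q \<le> ereal n" using upper[of n] bdd(1) by force
  have lb: "ereal (- n) \<le> Liminf (at x) Q" using lower[of "- n"] bdd(2) by force
  have "Liminf (at x) Q = Limsup (at x) Q"
  proof (rule ccontr)
    assume "Liminf (at x) Q \<noteq> Limsup (at x) Q"
    then have "Liminf (at x) Q < Limsup (at x) Q" using le by simp
    then obtain p0 where p0: "Liminf (at x) Q < ereal p0" "ereal p0 < Limsup (at x) Q"
      using ereal_dense2 by blast
    obtain q0 where q0: "ereal p0 < ereal q0" "ereal q0 < Limsup (at x) Q"
      using ereal_dense2[OF p0(2)] by blast
    \<comment> \<open>A separating point, so that the rationals chosen on its two sides satisfy
      \<open>p < q\<close>.\<close>
    obtain m0 where m0: "p0 < m0" "m0 < q0" using q0(1) dense by auto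
    obtain p where p: "p \<in> \<rat>" "p0 < p" "p < m0" using Rats_dense_in_real[OF m0(1)] by blast
    obtain q where q: "q \<in> \<rat>" "m0 < q" "q < q0" using Rats_dense_in_real[OF m0(2)] by blast
    have "Liminf (at x) Q < ereal p" "ereal q < Limsup (at x) Q"
      using less_trans[OF p0(1), of "ereal p"] less_trans[OF _ q0(2), of "ereal q"] p(2) q(3) by simp_all
    then show False using gap[OF p(1) q(1)] upper lower p q by auto
  qed
  then obtain l where "Liminf (at x) Q = ereal l" "Limsup (at x) Q = ereal l"
    using ub lb by (cases "Limsup (at x) Q") auto
  then have "(Q \<longlongrightarrow> ereal l) (at x)" by (intro Liminf_eq_Limsup) simp_all
  then have "((\<lambda>y. (f y - f x) / (y - x)) \<longlongrightarrow> l) (at x)" by (simp add: Q_def)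
  then have "(f has_real_derivative l) (at x)" by (simp add: has_field_derivative_iff)
  then show ?thesis using real_differentiable_def by blast
qed

theorem abs_cont_on_imp_differentiable_ae:
  assumes f: "abs_cont_on {a..b} f"
  shows "negligible {x \<in> {a<..<b}. \<not> f differentiable (at x)}"
proof -
  define E where "E = (\<lambda>(p, q). {x \<in> {a<..<b}. steep_at f q x \<and> steep_at (\<lambda>x. - f x) (- p) x})"
  have E: "negligible (E (p, q))" if "p < q" for p q
  proof -
    \<comment> \<open>Subtracting the line of mean slope \<open>m\<close> turns slopes at least
      \<open>q\<close> and at most \<open>p\<close> into slopes at least \<open>(q - p) / 2\<close>
      and at most its negative, the symmetric case already settled.\<close>
    define m where "m = (p + q) / 2"
    define h where "h = (\<lambda>x. f x + (- m) * x)"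
    have "abs_cont_on {a..b} (\<lambda>x. (- m) * x)"
      by (rule abs_cont_on_C1[where f' = "\<lambda>_. - m"]) (auto intro!: derivative_eq_intros)
    then have "abs_cont_on {a..b} h" unfolding h_def by (intro abs_cont_on_add f)
    then have neg: "negligible {x \<in> {a<..<b}. steep_at h ((q - p) / 2) x \<and> steep_at (\<lambda>x. - h x) ((q - p) / 2) x}"
      using that by (intro negligible_steep_both) auto
    have "q * (v - u) \<le> f v - f u \<longleftrightarrow> (q - p) / 2 * (v - u) \<le> h v - h u"
         "(- p) * (v - u) \<le> - f v - - f u \<longleftrightarrow> (q - p) / 2 * (v - u) \<le> - h v - - h u" for u v
      by (auto simp: h_def m_def field_simps)
    then have "steep_at f q x \<longleftrightarrow> steep_at h ((q - p) / 2) x"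
         "steep_at (\<lambda>x. - f x) (- p) x \<longleftrightarrow> steep_at (\<lambda>x. - h x) ((q - p) / 2) x" for x
      unfolding steep_at_def by simp_all
    then show ?thesis using neg by (simp add: E_def)
  qed
  define Z where "Z = {(p::real, q). p \<in> \<rat> \<and> q \<in> \<rat> \<and> p < q}"
  have "countable Z"
    by (rule countable_subset[of _ "Sigma \<rat> (\<lambda>_. \<rat>)"]) (auto simp: Z_def countable_rat)
  then have "negligible (\<Union>i\<in>Z. E i)" using E by (intro negligible_countable_Union) (auto simp: Z_def)
  then have "negligible ((\<Union>i\<in>Z. E i) \<union> {x \<in> {a<..<b}. \<forall>n::nat. steep_at f n x \<or> steep_at (\<lambda>x. - f x) n x})"
    using negligible_steep_unbounded[OF f] by (rule negligible_Un)
  then show ?thesis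
  proof (rule negligible_subset, intro subsetI UnCI)
    fix x assume x: "x \<in> {x \<in> {a<..<b}. \<not> f differentiable (at x)}"
      and "x \<notin> {x \<in> {a<..<b}. \<forall>n::nat. steep_at f n x \<or> steep_at (\<lambda>x. - f x) n x}"
    then obtain n :: nat where n: "\<not> steep_at f n x" "\<not> steep_at (\<lambda>x. - f x) n x" by blast
    obtain p q where "p \<in> \<rat>" "q \<in> \<rat>" "p < q" "steep_at f q x" "steep_at (\<lambda>x. - f x) (- p) x"
      using differentiable_if_not_steep[of f x n] x n by blast
    then show "x \<in> (\<Union>i\<in>Z. E i)" using x by (auto simp: Z_def E_def)
  qed
qed

section \<open>The fundamental theorem of calculus\<close>

lemma null_covered_by_small_open:
  assumes "negligible N" "e > 0"
  obtains U where "open U" "N \<subseteq> U" "U \<in> lmeasurable" "measure lebesgue U < e"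
proof -
  have N: "N \<in> null_sets lebesgue" using assms(1) by (simp add: negligible_iff_null_sets)
  obtain U where U: "open U" "N \<subseteq> U" "U - N \<in> lmeasurable" "emeasure lebesgue (U - N) < ennreal e"
    using sets_lebesgue_outer_open[of N e] N \<open>e > 0\<close> by (metis null_setsD2)
  have "U = (U - N) \<union> N" using U(2) by blast
  then have lm: "U \<in> lmeasurable"
    using fmeasurable.Un[OF U(3) negligible_imp_measurable[OF assms(1)]] by simp
  have "emeasure lebesgue U = emeasure lebesgue (U - N)"
    using emeasure_Diff_null_set[OF N] lm by (simp add: fmeasurableD)
  then have "measure lebesgue U < e"
    using U(4) emeasure_eq_measure2[OF lm] by (metis ennreal_less_iff measure_nonneg)
  then show thesis using that U lm by blast
qed

text \<open>Henstock's straddle lemma: both ends are compared with the point \<open>x\<close>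
  between them, and the errors \<open>e * (v - x)\<close> and \<open>e * (x - u)\<close> add up to
  \<open>e * (v - u)\<close>.\<close>

lemma straddle_bound:
  fixes h :: "real \<Rightarrow> real"
  assumes "(h has_real_derivative D) (at x)" "e > 0"
  obtains d where "d > 0"
    "\<And>u v. u \<le> x \<Longrightarrow> x \<le> v \<Longrightarrow> {u..v} \<subseteq> ball x d \<Longrightarrow> \<bar>(v - u) * D - (h v - h u)\<bar> \<le> e * (v - u)"
proof -
  have "(h has_derivative (\<lambda>y. D * y)) (at x)"
    using assms(1) by (simp add: has_field_derivative_def)
  then obtain d where d: "d > 0" "\<And>y. \<bar>y - x\<bar> < d \<Longrightarrow> \<bar>h y - h x - D * (y - x)\<bar> \<le> e * \<bar>y - x\<bar>"
    using assms(2) unfolding has_derivative_at_alt by (metis real_norm_def)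
  show thesis
  proof (rule that[OF d(1)])
    fix u v assume uv: "u \<le> x" "x \<le> v" "{u..v} \<subseteq> ball x d"
    then have "u \<in> ball x d" "v \<in> ball x d" by (simp_all only: subset_iff atLeastAtMost_iff) auto
    then have "\<bar>h v - h x - D * (v - x)\<bar> \<le> e * \<bar>v - x\<bar>" "\<bar>h u - h x - D * (u - x)\<bar> \<le> e * \<bar>u - x\<bar>"
      using d(2)[of v] d(2)[of u] by (auto simp: dist_real_def)
    then have "\<bar>h v - h x - D * (v - x)\<bar> \<le> e * (v - x)" "\<bar>h u - h x - D * (u - x)\<bar> \<le> e * (x - u)"
      using uv by (simp_all add: abs_minus_commute)
    moreover have "(v - u) * D - (h v - h u) = (h u - h x - D * (u - x)) - (h v - h x - D * (v - x))"
      by (simp add: algebra_simps)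
    moreover have "e * (v - x) + e * (x - u) = e * (v - u)" by (simp add: algebra_simps)
    ultimately show "\<bar>(v - u) * D - (h v - h u)\<bar> \<le> e * (v - u)" by linarith
  qed
qed

text \<open>The gauge forces intervals tagged in \<open>N\<close> into an open set of small measure,
  where absolute continuity makes the increments of \<open>h\<close> sum to less than
  \<open>e / 2\<close>. At all other tags the straddle bound compares derivative and
  increment.\<close>

lemma abs_cont_on_has_integral:
  assumes h: "abs_cont_on {a..b} h" and ab: "a \<le> b" and N: "negligible N"
    and D: "\<And>x. x \<in> {a..b} - N \<Longrightarrow> (h has_real_derivative D x) (at x)"
  shows "(D has_integral (h b - h a)) {a..b}"
proof -
  \<comment> \<open>\<open>D\<close> is unconstrained on \<open>N\<close>. With the value 0 there,
    intervals tagged in \<open>N\<close> contribute only increments of \<open>h\<close>; the change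
    on a null set is undone at the end.\<close>
  define D0 where "D0 x = (if x \<in> N then 0 else D x)" for x
  have "(D0 has_integral (h b - h a)) {a..b}"
    unfolding has_integral_real
  proof (intro allI impI)
    fix e :: real assume e: "e > 0"
    define e1 where "e1 = e / (2 * (b - a + 1))"
    have e1: "e1 > 0" "e1 * (b - a) < e / 2" using e ab by (auto simp: e1_def field_simps)
    have "e / 2 > 0" using e by simp
    then obtain d where d: "d > 0" "\<And>P. finite P \<Longrightarrow> \<forall>(u, v)\<in>P. u < v \<and> {u..v} \<subseteq> {a..b} \<Longrightarrow>
       disjoint_family_on (\<lambda>(u, v). {u<..<v}) P \<Longrightarrow> (\<Sum>(u, v)\<in>P. v - u) < d \<Longrightarrow>
       (\<Sum>(u, v)\<in>P. \<bar>h v - h u\<bar>) < e / 2"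
      using abs_cont_onE[OF h] by blast
    obtain U where U: "open U" "N \<subseteq> U" "U \<in> lmeasurable" "measure lebesgue U < d"
      using null_covered_by_small_open[OF N d(1)] by blast
    have "\<exists>r>0. x \<in> {a..b} - N \<longrightarrow> (\<forall>u v. u \<le> x \<longrightarrow> x \<le> v \<longrightarrow> {u..v} \<subseteq> ball x r \<longrightarrow>
        \<bar>(v - u) * D x - (h v - h u)\<bar> \<le> e1 * (v - u))" for x
    proof (cases "x \<in> {a..b} - N")
      case True
      show ?thesis by (rule straddle_bound[OF D[OF True] e1(1)]) blast
    qed (use zero_less_one in blast)
    then obtain r where r: "\<And>x. r x > 0" "\<And>x u v. x \<in> {a..b} - N \<Longrightarrow> u \<le> x \<Longrightarrow> x \<le> v \<Longrightarrow>
        {u..v} \<subseteq> ball x (r x) \<Longrightarrow> \<bar>(v - u) * D x - (h v - h u)\<bar> \<le> e1 * (v - u)"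
      by metis
    define \<gamma> where "\<gamma> x = (if x \<in> N then U else ball x (r x))" for x
    have gauge: "gauge \<gamma>" using U r(1) by (auto simp: gauge_def \<gamma>_def)
    have "norm ((\<Sum>(x, K)\<in>p. measure lborel K *\<^sub>R D0 x) - (h b - h a)) < e"
      if p: "p tagged_division_of {a..b}" and fine: "\<gamma> fine p" for p
    proof -
      note pD = tagged_division_ofD[OF p]
      have K: "\<exists>u v. K = {u..v} \<and> u \<le> x \<and> x \<le> v \<and> a \<le> u \<and> v \<le> b" if "(x, K) \<in> p" for x K
        using pD(2-4)[OF that] by fastforce
      define \<phi> where "\<phi> = (\<lambda>(x::real, K::real set). \<bar>measure lborel K * D0 x - (h (Sup K) - h (Inf K))\<bar>)"
      define q where "q = {(x, K) \<in> p. x \<in> N}"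
      \<comment> \<open>Degenerate intervals are removed because \<open>abs_cont_on\<close> asks for
        \<open>u < v\<close>, and because only nondegenerate members of \<open>p\<close> are
        determined by their end points: two with the same end points would overlap.\<close>
      define q' where "q' = {(x, K) \<in> p. x \<in> N \<and> Inf K < Sup K}"
      define P where "P = (\<lambda>(x::real, K::real set). (Inf K, Sup K)) ` q'"
      have fin: "finite q" "finite q'" "finite P" "q' \<subseteq> q" "q \<subseteq> p"
        using pD(1) by (auto simp: q_def q'_def P_def intro: rev_finite_subset)
      have disj: "{Inf K1<..<Sup K1} \<inter> {Inf K2<..<Sup K2} = {}"
        if "(x1, K1) \<in> q'" "(x2, K2) \<in> q'" "(x1, K1) \<noteq> (x2, K2)" for x1 K1 x2 K2
      proof -
        have "interior K1 \<inter> interior K2 = {}" using that by (intro pD(5)[of x1 K1 x2 K2]) (auto simp: q'_def)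
        moreover have "interior K1 = {Inf K1<..<Sup K1}" "interior K2 = {Inf K2<..<Sup K2}"
          using K[of x1 K1] K[of x2 K2] that by (auto simp: q'_def interior_atLeastAtMost_real)
        ultimately show ?thesis by simp
      qed
      have inj: "inj_on (\<lambda>(x, K). (Inf K, Sup K)) q'"
      proof (rule inj_onI, clarify)
        fix x1 K1 x2 K2 assume 1: "(x1, K1) \<in> q'" "(x2, K2) \<in> q'" "Inf K1 = Inf K2" "Sup K1 = Sup K2"
        have "(Inf K1 + Sup K1) / 2 \<in> {Inf K1<..<Sup K1}" using 1(1) by (auto simp: q'_def)
        then show "x1 = x2 \<and> K1 = K2" using disj[OF 1(1,2)] 1(3,4) by auto
      qed
      have Pq: "(u, v) \<in> P \<longleftrightarrow> (\<exists>x K. (x, K) \<in> q' \<and> u = Inf K \<and> v = Sup K)" for u v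
        by (auto simp: P_def)
      have sub: "{Inf K..Sup K} = K" "K \<subseteq> U" "K \<subseteq> {a..b}" if "(x, K) \<in> q'" for x K
        using K[of x K] that fineD[OF fine, of x K] by (auto simp: q'_def \<gamma>_def)
      have Pdisj: "disjoint_family_on (\<lambda>(u, v). {u<..<v}) P"
        unfolding disjoint_family_on_def using disj by (fastforce simp: Pq)
      have "(\<Sum>(u, v)\<in>P. v - u) = (\<Sum>i\<in>P. measure lebesgue (case i of (u, v) \<Rightarrow> {u<..<v}))"
        by (intro sum.cong) (auto simp: Pq q'_def)
      also have "\<dots> = measure lebesgue (\<Union>i\<in>P. case i of (u, v) \<Rightarrow> {u<..<v})"
        by (rule measure_finite_Union[symmetric]) (use fin Pdisj in \<open>auto simp: Pq q'_def\<close>)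
      also have "\<dots> \<le> measure lebesgue U"
      proof (rule measure_mono_fmeasurable[OF _ _ U(3)])
        have "{Inf K<..<Sup K} \<subseteq> U" if "(x, K) \<in> q'" for x K
          using sub(1,2)[OF that] by (metis greaterThanLessThan_subseteq_atLeastAtMost_iff order_refl subset_trans)
        then have "{u<..<v} \<subseteq> U" if "(u, v) \<in> P" for u v
          using that unfolding Pq by blast
        then show "(\<Union>i\<in>P. case i of (u, v) \<Rightarrow> {u<..<v}) \<subseteq> U"
          by (intro UN_least) (simp add: case_prod_unfold)
      qed (use fin in auto)
      finally have "(\<Sum>(u, v)\<in>P. v - u) < d" using U(4) by simp
      moreover have "Inf K < Sup K \<and> {Inf K..Sup K} \<subseteq> {a..b}" if "(x, K) \<in> q'" for x K
        using sub(1,3)[OF that] that by (simp add: q'_def)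
      then have "u < v \<and> {u..v} \<subseteq> {a..b}" if "(u, v) \<in> P" for u v
        using that unfolding Pq by blast
      then have "\<forall>(u, v)\<in>P. u < v \<and> {u..v} \<subseteq> {a..b}" by blast
      ultimately have "(\<Sum>(u, v)\<in>P. \<bar>h v - h u\<bar>) < e / 2" using d(2) fin Pdisj by blast
      moreover have "(\<Sum>(u, v)\<in>P. \<bar>h v - h u\<bar>) = (\<Sum>i\<in>q'. \<phi> i)"
        unfolding P_def sum.reindex[OF inj] by (intro sum.cong) (auto simp: \<phi>_def D0_def q'_def)
      moreover have "(\<Sum>i\<in>q'. \<phi> i) = (\<Sum>i\<in>q. \<phi> i)"
      proof (rule sum.mono_neutral_left)
        have "Inf K = Sup K" if "(x, K) \<in> q - q'" for x K
          using K[of x K] that by (fastforce simp: q_def q'_def)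
        then show "\<forall>i\<in>q - q'. \<phi> i = 0" by (auto simp: \<phi>_def D0_def q_def)
      qed (use fin in auto)
      ultimately have null: "(\<Sum>i\<in>q. \<phi> i) < e / 2" by simp
      have "\<phi> (x, K) \<le> e1 * (Sup K - Inf K)" if xK: "(x, K) \<in> p - q" for x K
      proof -
        have x: "(x, K) \<in> p" "x \<notin> N" using xK by (auto simp: q_def)
        obtain u v where uv: "K = {u..v}" "u \<le> x" "x \<le> v" "a \<le> u" "v \<le> b" using K[OF x(1)] by blast
        moreover have "K \<subseteq> ball x (r x)" using fineD[OF fine x(1)] x(2) by (simp add: \<gamma>_def)
        ultimately have "\<bar>(v - u) * D x - (h v - h u)\<bar> \<le> e1 * (v - u)" using r(2)[of x u v] x(2) by auto
        then show ?thesis using uv x(2) by (simp add: \<phi>_def D0_def)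
      qed
      then have "(\<Sum>i\<in>p - q. \<phi> i) \<le> (\<Sum>(x, K)\<in>p - q. e1 * (Sup K - Inf K))"
        by (intro sum_mono) auto
      also have "\<dots> \<le> (\<Sum>(x, K)\<in>p. e1 * (Sup K - Inf K))"
        using K e1(1) pD(1) by (intro sum_mono2) fastforce+
      also have "\<dots> = e1 * (b - a)"
        using additive_tagged_division_1[OF ab p, of "\<lambda>x. e1 * x"] by (simp add: right_diff_distrib)
      finally have regular: "(\<Sum>i\<in>p - q. \<phi> i) < e / 2" using e1(2) by simp
      have "(\<Sum>(x, K)\<in>p. measure lborel K *\<^sub>R D0 x) - (h b - h a)
          = (\<Sum>(x, K)\<in>p. measure lborel K * D0 x - (h (Sup K) - h (Inf K)))"
        unfolding additive_tagged_division_1[OF ab p, of h, symmetric]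
        by (simp add: sum_subtractf case_prod_unfold)
      also have "\<bar>\<dots>\<bar> \<le> (\<Sum>i\<in>p. \<phi> i)"
        unfolding \<phi>_def by (rule order_trans[OF sum_abs]) (auto intro!: sum_mono)
      also have "\<dots> = (\<Sum>i\<in>p - q. \<phi> i) + (\<Sum>i\<in>q. \<phi> i)"
        by (rule sum.subset_diff) (use fin pD(1) in auto)
      finally show ?thesis using null regular by simp
    qed
    with gauge show "\<exists>\<gamma>. gauge \<gamma> \<and> (\<forall>p. p tagged_division_of {a..b} \<and> \<gamma> fine p \<longrightarrow>
        norm ((\<Sum>(x, K)\<in>p. measure lborel K *\<^sub>R D0 x) - (h b - h a)) < e)"
      by (intro exI[of _ \<gamma>] conjI allI impI) simp_all
  qed
  then show ?thesis
    by (rule has_integral_spike[OF N, rotated]) (auto simp: D0_def)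
qed

text \<open>Upgrades the gauge integral to a Lebesgue integral. Over the intervals of a division the
  integrals of \<open>D\<close> are increments of \<open>h\<close>, dominated by those of its total
  variation, which telescope.\<close>

lemma abs_cont_on_absolutely_integrable:
  assumes h: "abs_cont_on {a..b} h" and ab: "a \<le> b" and N: "negligible N"
    and D: "\<And>x. x \<in> {a..b} - N \<Longrightarrow> (h has_real_derivative D x) (at x)"
  shows "D absolutely_integrable_on {a..b}"
proof -
  define V where "V = total_variation h a"
  have int: "integral {u..v} D = h v - h u" if "a \<le> u" "u \<le> v" "v \<le> b" for u v
  proof (rule integral_unique, rule abs_cont_on_has_integral[OF _ that(2) N])
    show "abs_cont_on {u..v} h" using that by (intro abs_cont_on_subset[OF h]) auto
  qed (use that D in auto)
  have "D absolutely_integrable_on cbox a b"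
  proof (rule bounded_variation_absolutely_integrable_interval)
    show "D integrable_on cbox a b"
      using abs_cont_on_has_integral[OF assms] by (auto simp: integrable_on_def)
    fix d assume d: "d division_of cbox a b"
    note dD = division_ofD[OF d]
    have K: "\<exists>u v. K = {u..v} \<and> u \<le> v \<and> a \<le> u \<and> v \<le> b" if "K \<in> d" for K
      using dD(2-4)[OF that] by fastforce
    \<comment> \<open>Tagging each interval by its left end makes the telescoping lemma for tagged
      divisions applicable.\<close>
    have p: "(\<lambda>K. (Inf K, K)) ` d tagged_division_of {a..b}"
    proof (rule tagged_division_ofI)
      show "\<Union>{K. \<exists>x. (x, K) \<in> (\<lambda>K. (Inf K, K)) ` d} = {a..b}" using dD(6) by (simp add: image_iff)
    qed (use dD(1) K dD(5) in \<open>fastforce+\<close>)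
    have "(\<Sum>K\<in>d. norm (integral K D)) \<le> (\<Sum>K\<in>d. V (Sup K) - V (Inf K))"
    proof (rule sum_mono)
      fix K assume "K \<in> d"
      then obtain u v where "K = {u..v}" "u \<le> v" "a \<le> u" "v \<le> b" using K by blast
      then show "norm (integral K D) \<le> V (Sup K) - V (Inf K)"
        using int[of u v] abs_cont_on_total_variation(2)[OF h, of u v] by (simp add: V_def)
    qed
    also have "\<dots> = (\<Sum>(x, K)\<in>(\<lambda>K. (Inf K, K)) ` d. V (Sup K) - V (Inf K))"
      by (subst sum.reindex) (auto simp: inj_on_def)
    also have "\<dots> = V b - V a" by (rule additive_tagged_division_1[OF ab p])
    finally show "(\<Sum>K\<in>d. norm (integral K D)) \<le> V b - V a" .
  qed
  then show ?thesis by simp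
qed

section \<open>Integrals of radial functions over the cylinder\<close>

lemma cylinder_lmeasurable: "cylinder R L \<in> lmeasurable"
proof (rule lmeasurable_compact, rule compact_eq_bounded_closed[THEN iffD2], rule conjI)
  have "norm x \<le> \<bar>R\<bar> + \<bar>R\<bar> + \<bar>L\<bar>" if "x \<in> cylinder R L" for x
  proof -
    have x: "(x$1)\<^sup>2 + (x$2)\<^sup>2 \<le> R\<^sup>2" "\<bar>x$3\<bar> \<le> \<bar>L\<bar>" using that by (auto simp: cylinder_def)
    have "(x$1)\<^sup>2 \<le> R\<^sup>2" "(x$2)\<^sup>2 \<le> R\<^sup>2" using x(1) by (smt (verit) zero_le_power2)+
    then have "\<bar>x$1\<bar> \<le> \<bar>R\<bar>" "\<bar>x$2\<bar> \<le> \<bar>R\<bar>" by (simp_all add: abs_le_square_iff)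
    then show ?thesis using norm_le_l1_cart[of x] x(2) by (simp add: sum_3)
  qed
  then show "bounded (cylinder R L)" by (auto simp: bounded_iff)
  show "closed (cylinder R L)"
    unfolding cylinder_def by (intro closed_Collect_conj closed_Collect_le continuous_intros)
qed

lemma measure_cylinder_pos:
  assumes "R > 0" "L > 0"
  shows "measure lebesgue (cylinder R L) > 0"
proof (rule ccontr)
  assume "\<not> ?thesis"
  then have "measure lebesgue (cylinder R L) = 0" using measure_nonneg[of lebesgue] by (metis less_eq_real_def)
  then have neg: "negligible (cylinder R L)"
    using cylinder_lmeasurable by (simp add: negligible_iff_measure)
  define S where "S = {x::real^3. (x$1)\<^sup>2 + (x$2)\<^sup>2 < R\<^sup>2 \<and> 0 < x$3 \<and> x$3 < L}"
  have "open S" unfolding S_def by (intro open_Collect_conj open_Collect_less continuous_intros)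
  moreover have "vector [0, 0, L / 2] \<in> S" using assms by (simp add: S_def)
  moreover have "negligible S" by (rule negligible_subset[OF neg]) (auto simp: S_def cylinder_def)
  ultimately show False using open_not_negligible by blast
qed

lemma borel_measurable_rad [measurable]: "rad \<in> borel_measurable borel"
  unfolding rad_def by (intro borel_measurable_continuous_onI continuous_intros)

lemma rad_nonneg: "rad x \<ge> 0" by (simp add: rad_def)

lemma cylinder_iff: "R > 0 \<Longrightarrow> x \<in> cylinder R L \<longleftrightarrow> rad x \<le> R \<and> 0 \<le> x$3 \<and> x$3 \<le> L"
  unfolding cylinder_def rad_def using real_sqrt_le_iff[of "(x$1)\<^sup>2 + (x$2)\<^sup>2" "R\<^sup>2"] by simp

text \<open>Stretching the cross-section by \<open>\<rho>\<close> avoids computing any volume.\<close>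

lemma measure_subcylinder:
  assumes R: "R > 0" and \<rho>: "0 \<le> \<rho>" "\<rho> \<le> 1"
  shows "measure lebesgue {x \<in> cylinder R L. rad x / R \<le> \<rho>} = \<rho>\<^sup>2 * measure lebesgue (cylinder R L)"
\<comment> \<open>For \<rho> = 0 the stretch below is not invertible; the set then lies on the axis
  and is null.\<close>
proof (cases "\<rho> = 0")
  case True
  have "{x \<in> cylinder R L. rad x / R \<le> \<rho>} \<subseteq> {x. x$1 = 0}"
    using R True rad_nonneg by (auto simp: divide_le_0_iff rad_def sum_power2_le_zero_iff)
  then have neg: "negligible {x \<in> cylinder R L. rad x / R \<le> \<rho>}"
    by (rule negligible_subset[OF negligible_standard_hyperplane_cart])
  show ?thesis unfolding negligible_imp_measure0[OF neg] using True by simp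
next
  case False
  then have pos: "\<rho> > 0" using \<rho> by simp
  define m where "m = (\<lambda>k::3. if k = 3 then 1 else \<rho>)"
  let ?s = "\<lambda>x::real^3. \<chi> k. m k * x$k"
  have rad: "rad (?s x) = \<rho> * rad x" for x
    using pos by (simp add: rad_def m_def power_mult_distrib real_sqrt_mult flip: distrib_left)
  have "?s ` cylinder R L = {x \<in> cylinder R L. rad x / R \<le> \<rho>}"
  proof (intro equalityI subsetI)
    fix y assume "y \<in> ?s ` cylinder R L"
    then obtain x where x: "x \<in> cylinder R L" "y = ?s x" by blast
    have "\<rho> * rad x \<le> \<rho> * R" using x(1) pos by (simp add: cylinder_iff[OF R])
    moreover have "\<rho> * R \<le> R" using \<rho> R by simp
    ultimately have "\<rho> * rad x \<le> \<rho> * R" "\<rho> * rad x \<le> R" by linarith+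
    then have "rad y / R \<le> \<rho>" "rad y \<le> R"
      using x(2) rad[of x] R by (simp_all add: pos_divide_le_eq)
    moreover have "y$3 = x$3" using x(2) by (simp add: m_def)
    ultimately show "y \<in> {x \<in> cylinder R L. rad x / R \<le> \<rho>}"
      using x(1) by (simp add: cylinder_iff[OF R])
  next
    fix y assume y: "y \<in> {x \<in> cylinder R L. rad x / R \<le> \<rho>}"
    define x where "x = (\<chi> k. y$k / m k)"
    have yx: "y = ?s x" using pos by (simp add: x_def vec_eq_iff m_def)
    have "rad y = \<rho> * rad x" using rad[of x] yx by simp
    then have "rad x \<le> R" using y R pos by (simp add: pos_divide_le_eq)
    then have "x \<in> cylinder R L" using y by (simp add: cylinder_iff[OF R]) (simp add: x_def m_def)
    then show "y \<in> ?s ` cylinder R L" using yx by blast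
  qed
  moreover have "prod m UNIV = \<rho>\<^sup>2" unfolding UNIV_3 by (simp add: m_def power2_eq_square)
  ultimately show ?thesis
    using measure_stretch[OF cylinder_lmeasurable[of R L], of m] by simp
qed

text \<open>Stands in for polar coordinates. Both measures are finite on the rays
  \<open>{t<..}\<close> and agree there: subcylinders have volume \<open>C * \<rho>\<^sup>2\<close>,
  whose derivative is the density.\<close>

lemma distr_cylinder_rad:
  fixes R L :: real
  assumes R: "R > 0"
  defines "C \<equiv> measure lebesgue (cylinder R L)"
  shows "distr (lebesgue_on (cylinder R L)) borel (\<lambda>x. rad x / R)
       = density lborel (\<lambda>\<rho>. ennreal (2 * C * \<rho> * indicator {0..1} \<rho>))" (is "?M = ?N")
proof (rule measure_eqI_lessThan)
  have cyl: "cylinder R L \<in> sets lebesgue" using cylinder_lmeasurable by (rule fmeasurableD)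
  have [measurable]: "(\<lambda>x. rad x / R) \<in> borel_measurable lebesgue"
    by (rule measurable_completion) simp
  have meas: "(\<lambda>x. rad x / R) \<in> borel_measurable (lebesgue_on (cylinder R L))"
    by (rule measurable_restrict_space1) simp
  have C0: "C \<ge> 0" by (simp add: C_def)
  have em: "emeasure ?M A = ennreal (measure lebesgue {x \<in> cylinder R L. rad x / R \<in> A})" if A: "A \<in> sets borel" for A
  proof -
    have "{x. rad x / R \<in> A} \<in> sets lebesgue"
      using measurable_sets[of "\<lambda>x. rad x / R" lebesgue borel A] A by (simp add: vimage_def)
    then have "{x \<in> cylinder R L. rad x / R \<in> A} \<in> lmeasurable"
      using fmeasurable_Int_fmeasurable[OF cylinder_lmeasurable[of R L]] by (simp add: Collect_conj_eq)
    moreover have "emeasure ?M A = emeasure lebesgue {x \<in> cylinder R L. rad x / R \<in> A}"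
      using A cyl by (subst emeasure_distr[OF meas]) (auto simp: emeasure_restrict_space vimage_def Int_def conj_commute)
    ultimately show ?thesis by (simp add: emeasure_eq_measure2)
  qed
  have M: "emeasure ?M {t<..} = ennreal (C - C * (max 0 (min t 1))\<^sup>2)" for t
  proof (cases "t < 0")
    case True
    then have "{x \<in> cylinder R L. rad x / R \<in> {t<..}} = cylinder R L"
      using R rad_nonneg by (auto intro: less_le_trans divide_nonneg_pos)
    then show ?thesis using em[of "{t<..}"] True by (simp add: C_def)
  next
    case False
    define u where "u = min t 1"
    have u: "0 \<le> u" "u \<le> 1" using False by (auto simp: u_def)
    have eq: "{x \<in> cylinder R L. rad x / R \<in> {t<..}} = cylinder R L - {x \<in> cylinder R L. rad x / R \<le> u}"
    proof -
      have "rad x / R \<le> 1" if "x \<in> cylinder R L" for x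
        using that R by (simp add: cylinder_iff[OF R])
      then show ?thesis unfolding u_def by force
    qed
    have "{x. rad x / R \<le> u} \<in> sets lebesgue"
      using measurable_sets[of "\<lambda>x. rad x / R" lebesgue borel "{..u}"] by (simp add: vimage_def)
    then have "{x \<in> cylinder R L. rad x / R \<le> u} \<in> lmeasurable"
      using fmeasurable_Int_fmeasurable[OF cylinder_lmeasurable[of R L]] by (simp add: Collect_conj_eq)
    then have "measure lebesgue {x \<in> cylinder R L. rad x / R \<in> {t<..}} = C - u\<^sup>2 * C"
      unfolding eq C_def measure_subcylinder[OF R u, of L, symmetric]
      by (intro measurable_measure_Diff cylinder_lmeasurable) (auto simp: fmeasurableD)
    then show ?thesis using em[of "{t<..}"] False u by (simp add: u_def mult.commute)
  qed
  have N: "emeasure ?N {t<..} = ennreal (C - C * (max 0 (min t 1))\<^sup>2)" for t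
  proof -
    define u where "u = max 0 (min t 1)"
    have u: "0 \<le> u" "u \<le> 1" by (auto simp: u_def)
    have "emeasure ?N {t<..} = (\<integral>\<^sup>+\<rho>. ennreal (2 * C * \<rho> * indicator {0..1} \<rho>) * indicator {t<..} \<rho> \<partial>lborel)"
      by (rule emeasure_density) auto
    also have "\<dots> = (\<integral>\<^sup>+\<rho>. ennreal (2 * C * \<rho>) * indicator {u..1} \<rho> \<partial>lborel)"
    proof (rule nn_integral_cong_AE)
      have "AE \<rho> in lborel. \<rho> \<noteq> u \<and> \<rho> \<noteq> 1" using AE_lborel_singleton[of u] AE_lborel_singleton[of 1] by eventually_elim auto
      then show "AE \<rho> in lborel. ennreal (2 * C * \<rho> * indicator {0..1} \<rho>) * indicator {t<..} \<rho>
          = ennreal (2 * C * \<rho>) * indicator {u..1} \<rho>"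
        by eventually_elim (auto simp: u_def indicator_def)
    qed
    also have "\<dots> = ennreal (C * 1\<^sup>2 - C * u\<^sup>2)"
      by (rule nn_integral_FTC_Icc) (use u C0 in \<open>auto intro!: derivative_eq_intros\<close>)
    finally show ?thesis by (simp add: u_def)
  qed
  show "emeasure ?M {t<..} = emeasure ?N {t<..}" for t unfolding M N ..
  show "emeasure ?M {t<..} < \<infinity>" for t unfolding M by simp
qed simp_all

lemma AE_cylinder_rad:
  assumes R: "R > 0" and P: "AE \<rho> in lborel. 0 < \<rho> \<longrightarrow> \<rho> < 1 \<longrightarrow> P \<rho>"
  shows "AE x in lebesgue_on (cylinder R L). P (rad x / R)"
proof -
  obtain N where N: "N \<in> null_sets lborel" "{\<rho>. \<not> (0 < \<rho> \<longrightarrow> \<rho> < 1 \<longrightarrow> P \<rho>)} \<subseteq> N"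
    using P unfolding eventually_ae_filter by auto
  \<comment> \<open>The end points are discarded because \<open>P\<close> is given only on the open
    interval. The set \<open>{0..1} - N'\<close> is Borel, as the transfer through
    \<open>distr\<close> requires.\<close>
  define N' where "N' = N \<union> {0, 1}"
  have N': "N' \<in> null_sets lborel" using N(1) unfolding N'_def
    by (intro null_sets.Un[OF N(1)] finite_imp_null_set_lborel) auto
  have meas: "(\<lambda>x. rad x / R) \<in> borel_measurable (lebesgue_on (cylinder R L))"
    by (intro measurable_restrict_space1 measurable_completion) simp
  have borel: "{\<rho>. \<rho> \<in> {0..1} - N'} \<in> sets borel" using N' by (auto simp: null_sets_def)
  have "AE \<rho> in lborel. \<rho> \<notin> N'" using N' by (rule AE_not_in)
  then have "AE \<rho> in distr (lebesgue_on (cylinder R L)) borel (\<lambda>x. rad x / R). \<rho> \<in> {0..1} - N'"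
    unfolding distr_cylinder_rad[OF R]
    by (subst AE_density) (auto elim!: eventually_mono simp: indicator_def split: if_splits)
  then have "AE x in lebesgue_on (cylinder R L). rad x / R \<in> {0..1} - N'"
    by (subst (asm) AE_distr_iff[OF meas]) (use borel in auto)
  moreover have "P \<rho>" if "\<rho> \<in> {0..1} - N'" for \<rho>
  proof -
    have "0 < \<rho>" "\<rho> < 1" "\<rho> \<notin> N" using that by (auto simp: N'_def less_le)
    then show ?thesis using N(2) by blast
  qed
  ultimately show ?thesis by (rule eventually_mono)
qed

text \<open>\<open>F\<close> may change sign: the weight is nonnegative, so the truncation at 0 done
  by \<open>ennreal\<close> commutes with it. This serves both the positive and the negative part of
  the energy density.\<close>

lemma nn_integral_cylinder_rad:
  assumes R: "R > 0" and F: "F \<in> borel_measurable borel"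
  shows "(\<integral>\<^sup>+x. ennreal (F (rad x / R)) \<partial>lebesgue_on (cylinder R L)) =
     (\<integral>\<^sup>+\<rho>. ennreal (2 * measure lebesgue (cylinder R L) * \<rho> * F \<rho> * indicator {0..1} \<rho>) \<partial>lborel)"
proof -
  have meas: "(\<lambda>x. rad x / R) \<in> borel_measurable (lebesgue_on (cylinder R L))"
    by (intro measurable_restrict_space1 measurable_completion) simp
  have [measurable]: "F \<in> borel_measurable borel" by (rule F)
  have "(\<integral>\<^sup>+x. ennreal (F (rad x / R)) \<partial>lebesgue_on (cylinder R L))
      = (\<integral>\<^sup>+\<rho>. ennreal (F \<rho>) \<partial>distr (lebesgue_on (cylinder R L)) borel (\<lambda>x. rad x / R))"
    by (subst nn_integral_distr[OF meas]) auto
  also have "\<dots> = (\<integral>\<^sup>+\<rho>. ennreal (2 * measure lebesgue (cylinder R L) * \<rho> * indicator {0..1} \<rho>) * ennreal (F \<rho>) \<partial>lborel)"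
    unfolding distr_cylinder_rad[OF R] by (rule nn_integral_density) auto
  also have "\<dots> = (\<integral>\<^sup>+\<rho>. ennreal (2 * measure lebesgue (cylinder R L) * \<rho> * F \<rho> * indicator {0..1} \<rho>) \<partial>lborel)"
  proof (rule nn_integral_cong)
    fix \<rho> :: real
    let ?w = "2 * measure lebesgue (cylinder R L) * \<rho> * indicator {0..1} \<rho>"
    have "0 \<le> ?w" by (simp add: indicator_def)
    then have "ennreal ?w * ennreal (F \<rho>) = ennreal (?w * F \<rho>)" by (rule ennreal_mult'[symmetric])
    then show "ennreal ?w * ennreal (F \<rho>) =
        ennreal (2 * measure lebesgue (cylinder R L) * \<rho> * F \<rho> * indicator {0..1} \<rho>)"
      by (simp only: mult_ac)
  qed
  finally show ?thesis .
qed

section \<open>Differential operators in cylindrical coordinates\<close>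

definition cyl_vec :: "real^3 \<Rightarrow> real \<Rightarrow> real \<Rightarrow> real \<Rightarrow> real^3" where
  "cyl_vec x a b c = a *\<^sub>R e_r x + b *\<^sub>R e_theta x + c *\<^sub>R e_z"

lemma cyl_vec_component:
  "cyl_vec x a b c $ 1 = a * (x$1 / rad x) - b * (x$2 / rad x)"
  "cyl_vec x a b c $ 2 = a * (x$2 / rad x) + b * (x$1 / rad x)"
  "cyl_vec x a b c $ 3 = c"
  by (simp_all add: cyl_vec_def e_r_def e_theta_def e_z_def)

lemma cos_sin_angle: "rad x > 0 \<Longrightarrow> (x$1 / rad x)\<^sup>2 + (x$2 / rad x)\<^sup>2 = 1"
  by (simp add: power_divide flip: add_divide_distrib) (simp add: rad_def)

lemma cyl_vec_linear:
  "cyl_vec x a b c + cyl_vec x a' b' c' = cyl_vec x (a + a') (b + b') (c + c')"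
  "cyl_vec x a b c - cyl_vec x a' b' c' = cyl_vec x (a - a') (b - b') (c - c')"
  "k *\<^sub>R cyl_vec x a b c = cyl_vec x (k * a) (k * b) (k * c)"
  by (simp_all add: cyl_vec_def algebra_simps)

lemma cyl_vec_inner:
  assumes "rad x > 0"
  shows "cyl_vec x a b c \<bullet> cyl_vec x a' b' c' = a * a' + b * b' + c * c'"
  unfolding inner_vec_def sum_3 cyl_vec_component inner_real_def
  using cos_sin_angle[OF assms] by algebra

lemma cyl_vec_cross:
  assumes "rad x > 0"
  shows "cyl_vec x a b c \<times> cyl_vec x a' b' c' = cyl_vec x (b * c' - c * b') (c * a' - a * c') (a * b' - b * a')"
proof -
  have "(cyl_vec x a b c \<times> cyl_vec x a' b' c') $ 3 = a * b' - b * a'"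
    unfolding cross_components cyl_vec_component using cos_sin_angle[OF assms] by algebra
  moreover have "(cyl_vec x a b c \<times> cyl_vec x a' b' c') $ i = cyl_vec x (b * c' - c * b') (c * a' - a * c') (a * b' - b * a') $ i"
    if "i = 1 \<or> i = 2" for i
    using that by (auto simp only: cross_components cyl_vec_component ring_distribs) (auto simp: algebra_simps)
  ultimately show ?thesis by (auto simp: vec_eq_iff forall_3 cyl_vec_component)
qed

definition cyl_field :: "real \<Rightarrow> (real \<Rightarrow> real) \<Rightarrow> (real \<Rightarrow> real) \<Rightarrow> (real \<Rightarrow> real) \<Rightarrow> real^3 \<Rightarrow> real^3" where
  "cyl_field R a b c x = cyl_vec x (a (rad x / R)) (b (rad x / R)) (c (rad x / R))"

lemma has_derivative_component: "((\<lambda>y::real^3. y$i) has_derivative (\<lambda>h. h$i)) (at x)"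
  by (rule bounded_linear_imp_has_derivative) (rule bounded_linear_vec_nth)

lemma has_derivative_rad:
  assumes "rad x > 0"
  shows "(rad has_derivative (\<lambda>h. x$1 / rad x * h$1 + x$2 / rad x * h$2)) (at x)"
proof -
  have pos: "(x$1)\<^sup>2 + (x$2)\<^sup>2 > 0" using assms by (simp add: rad_def)
  define A where "A = (\<lambda>y::real^3. (y$1)\<^sup>2 + (y$2)\<^sup>2)"
  have A: "(A has_derivative (\<lambda>h. 2 * x$1 * h$1 + 2 * x$2 * h$2)) (at x)"
    unfolding A_def by (auto intro!: derivative_eq_intros has_derivative_component)
  have sqrt: "DERIV sqrt (A x) :> inverse (sqrt (A x)) / 2"
    using pos by (intro DERIV_real_sqrt) (simp add: A_def)
  have der: "((\<lambda>y. sqrt (A y)) has_derivative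
      (\<lambda>h. (2 * x$1 * h$1 + 2 * x$2 * h$2) * (inverse (sqrt (A x)) / 2))) (at x)"
    by (rule DERIV_compose_FDERIV[OF sqrt A])
  have eq: "(2 * a * h1 + 2 * b * h2) * (inverse s / 2) = a / s * h1 + b / s * h2" for s a b h1 h2 :: real
    by (cases "s = 0") (simp_all add: field_simps)
  have rad: "rad = (\<lambda>y. sqrt (A y))" by (simp add: rad_def A_def fun_eq_iff)
  show ?thesis using der unfolding eq rad .
qed

text \<open>The quotients are cosine and sine of the angle \<vartheta>, and the bracket divided by
  \<open>rad x\<close> is its differential; in this form no branch of the angle has to be
  chosen.\<close>

lemma has_derivative_angle:
  assumes "rad x > 0"
  shows "((\<lambda>y. y$1 / rad y) has_derivative
      (\<lambda>h. - (x$2 / rad x) * (x$1 / rad x * h$2 - x$2 / rad x * h$1) / rad x)) (at x)"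
    and "((\<lambda>y. y$2 / rad y) has_derivative
      (\<lambda>h. (x$1 / rad x) * (x$1 / rad x * h$2 - x$2 / rad x * h$1) / rad x)) (at x)"
proof -
  have r: "rad x \<noteq> 0" using assms by simp
  have r2: "(rad x)\<^sup>2 = (x$1)\<^sup>2 + (x$2)\<^sup>2" by (simp add: rad_def)
  show "((\<lambda>y. y$1 / rad y) has_derivative
      (\<lambda>h. - (x$2 / rad x) * (x$1 / rad x * h$2 - x$2 / rad x * h$1) / rad x)) (at x)"
    apply (rule has_derivative_eq_rhs[OF has_derivative_divide[OF has_derivative_component has_derivative_rad[OF assms] r]])
    using r r2 by (simp add: fun_eq_iff divide_simps) algebra
  show "((\<lambda>y. y$2 / rad y) has_derivative
      (\<lambda>h. (x$1 / rad x) * (x$1 / rad x * h$2 - x$2 / rad x * h$1) / rad x)) (at x)"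
    apply (rule has_derivative_eq_rhs[OF has_derivative_divide[OF has_derivative_component has_derivative_rad[OF assms] r]])
    using r r2 by (simp add: fun_eq_iff divide_simps) algebra
qed

lemma has_derivative_radial:
  assumes "rad x > 0" "(a has_real_derivative a') (at (rad x / R))"
  shows "((\<lambda>y. a (rad y / R)) has_derivative
     (\<lambda>h. a' / R * (x$1 / rad x * h$1 + x$2 / rad x * h$2))) (at x)"
proof -
  have 1: "((\<lambda>y. rad y / R) has_derivative (\<lambda>h. (x$1 / rad x * h$1 + x$2 / rad x * h$2) / R)) (at x)"
    by (rule bounded_linear.has_derivative[OF bounded_linear_divide has_derivative_rad[OF assms(1)]])
  have 2: "(a has_derivative (\<lambda>h. a' * h)) (at (rad x / R))"
    using assms(2) by (simp add: has_field_derivative_def)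
  show ?thesis
    using has_derivative_compose[OF 1 2] by (rule has_derivative_eq_rhs) (simp add: fun_eq_iff)
qed

text \<open>\<open>p h\<close> and \<open>q h\<close> are the radial and azimuthal components of
  \<open>h\<close>. The terms with \<open>q\<close> come from the turning frame: d e_r = e_theta
  d\<vartheta> and d e_theta = - e_r d\<vartheta>.\<close>

lemma has_derivative_cyl_field:
  assumes r: "rad x > 0"
    and a: "(a has_real_derivative a') (at (rad x / R))"
    and b: "(b has_real_derivative b') (at (rad x / R))"
    and c: "(c has_real_derivative c') (at (rad x / R))"
  defines "\<rho> \<equiv> rad x / R"
  defines "p \<equiv> \<lambda>h::real^3. x$1 / rad x * h$1 + x$2 / rad x * h$2"
  defines "q \<equiv> \<lambda>h::real^3. x$1 / rad x * h$2 - x$2 / rad x * h$1"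
  shows "(cyl_field R a b c has_derivative
    (\<lambda>h. cyl_vec x (a' / R * p h - b \<rho> / rad x * q h) (b' / R * p h + a \<rho> / rad x * q h) (c' / R * p h))) (at x)"
proof -
  have p: "\<And>h. p h = x$1 / rad x * h$1 + x$2 / rad x * h$2"
    and q: "\<And>h. q h = x$1 / rad x * h$2 - x$2 / rad x * h$1" by (simp_all add: p_def q_def)
  note ang = has_derivative_angle[OF r, folded q]
  note ra = has_derivative_radial[OF r a, folded p] and rb = has_derivative_radial[OF r b, folded p]
    and rc = has_derivative_radial[OF r c, folded p]
  let ?D = "\<lambda>h. cyl_vec x (a' / R * p h - b \<rho> / rad x * q h) (b' / R * p h + a \<rho> / rad x * q h) (c' / R * p h)"
  have 1: "((\<lambda>y. cyl_field R a b c y $ 1) has_derivative (\<lambda>h. ?D h $ 1)) (at x)"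
    unfolding cyl_field_def cyl_vec_component
    by (rule has_derivative_diff[OF has_derivative_mult[OF ra ang(1)] has_derivative_mult[OF rb ang(2)],
          THEN has_derivative_eq_rhs]) (simp add: fun_eq_iff \<rho>_def algebra_simps)
  have 2: "((\<lambda>y. cyl_field R a b c y $ 2) has_derivative (\<lambda>h. ?D h $ 2)) (at x)"
    unfolding cyl_field_def cyl_vec_component
    by (rule has_derivative_add[OF has_derivative_mult[OF ra ang(2)] has_derivative_mult[OF rb ang(1)],
          THEN has_derivative_eq_rhs]) (simp add: fun_eq_iff \<rho>_def algebra_simps)
  have 3: "((\<lambda>y. cyl_field R a b c y $ 3) has_derivative (\<lambda>h. ?D h $ 3)) (at x)"
    unfolding cyl_field_def cyl_vec_component by (rule rc)
  have "\<forall>i. ((\<lambda>y. cyl_field R a b c y $ i) has_derivative (\<lambda>h. ?D h $ i)) (at x)"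
    unfolding forall_3 using 1 2 3 by blast
  then show ?thesis
    by (subst has_derivative_componentwise_within) (auto simp: Basis_vec_def inner_axis)
qed

lemma Jac_eq:
  assumes "(u has_derivative D) (at x)"
  shows "Jac u x $ i $ j = D (axis j 1) $ i"
  unfolding jacobian_def matrix_def frechet_derivative_at[OF assms, symmetric] by simp

text \<open>In the frame, the derivative along \<open>e_r\<close> has coefficients (a', b', c')/R,
  the one along \<open>e_theta\<close> has (-b, a, 0)/r, and the one along \<open>e_z\<close>
  vanishes. With the direction cosines \<open>C\<close>, \<open>S\<close> as variables, the
  Cartesian operators become polynomials to be reduced modulo C^2 + S^2 = 1.\<close>

lemma differential_operators_cyl_field:
  assumes r: "rad x > 0"
    and a: "(a has_real_derivative a') (at (rad x / R))"
    and b: "(b has_real_derivative b') (at (rad x / R))"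
    and c: "(c has_real_derivative c') (at (rad x / R))"
  defines "\<rho> \<equiv> rad x / R"
  shows "divg (cyl_field R a b c) x = a' / R + a \<rho> / rad x"
    and "curl (cyl_field R a b c) x = cyl_vec x 0 (- c' / R) (b' / R + b \<rho> / rad x)"
    and "tr_sq (cyl_field R a b c) x = (a' / R)\<^sup>2 + (a \<rho> / rad x)\<^sup>2 - 2 * (b \<rho> / rad x) * (b' / R)"
    and "grad (\<lambda>y. cyl_field R a b c y \<bullet> cyl_field R a b c y) x
       = cyl_vec x (2 * (a \<rho> * a' / R + b \<rho> * b' / R + c \<rho> * c' / R)) 0 0"
proof -
  define C S where "C = x$1 / rad x" and "S = x$2 / rad x"
  have CS: "C\<^sup>2 + S\<^sup>2 = 1" using cos_sin_angle[OF r] by (simp add: C_def S_def)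
  define A B G \<alpha> \<beta> where "A = a' / R" and "B = b' / R" and "G = c' / R"
    and "\<alpha> = a \<rho> / rad x" and "\<beta> = b \<rho> / rad x"
  note der = has_derivative_cyl_field[OF r a b c, folded \<rho>_def C_def S_def A_def B_def G_def \<alpha>_def \<beta>_def]
  note J = Jac_eq[OF der]
  have comp: "cyl_vec x a b c $ 1 = a * C - b * S" "cyl_vec x a b c $ 2 = a * S + b * C" "cyl_vec x a b c $ 3 = c" for a b c
    by (simp_all add: cyl_vec_component C_def S_def)
  show "divg (cyl_field R a b c) x = a' / R + a \<rho> / rad x"
    unfolding divg_def trace_def sum_3 A_def[symmetric] \<alpha>_def[symmetric] using CS
    by (simp add: J axis_def comp) algebra
  show "curl (cyl_field R a b c) x = cyl_vec x 0 (- c' / R) (b' / R + b \<rho> / rad x)"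
    unfolding vec_eq_iff forall_3 curl_def G_def[symmetric] B_def[symmetric] \<beta>_def[symmetric] minus_divide_left[symmetric] using CS
    by (simp add: J axis_def comp) algebra
  show "tr_sq (cyl_field R a b c) x = (a' / R)\<^sup>2 + (a \<rho> / rad x)\<^sup>2 - 2 * (b \<rho> / rad x) * (b' / R)"
    unfolding tr_sq_def trace_def matrix_matrix_mult_def sum_3 A_def[symmetric] B_def[symmetric] \<alpha>_def[symmetric] \<beta>_def[symmetric] using CS
    by (simp add: J axis_def comp) algebra
  have "((\<lambda>y. cyl_field R a b c y \<bullet> cyl_field R a b c y) has_derivative
     (\<lambda>h. cyl_field R a b c x \<bullet> cyl_vec x (A * (C * h$1 + S * h$2) - \<beta> * (C * h$2 - S * h$1)) (B * (C * h$1 + S * h$2) + \<alpha> * (C * h$2 - S * h$1)) (G * (C * h$1 + S * h$2))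
       + cyl_vec x (A * (C * h$1 + S * h$2) - \<beta> * (C * h$2 - S * h$1)) (B * (C * h$1 + S * h$2) + \<alpha> * (C * h$2 - S * h$1)) (G * (C * h$1 + S * h$2)) \<bullet> cyl_field R a b c x)) (at x)"
    by (rule has_derivative_inner[OF der der])
  note gr = frechet_derivative_at[OF this, symmetric]
  \<comment> \<open>This cancels the azimuthal derivative of the squared length.\<close>
  have ab: "a \<rho> * \<beta> = b \<rho> * \<alpha>" by (simp add: \<alpha>_def \<beta>_def)
  show "grad (\<lambda>y. cyl_field R a b c y \<bullet> cyl_field R a b c y) x
       = cyl_vec x (2 * (a \<rho> * a' / R + b \<rho> * b' / R + c \<rho> * c' / R)) 0 0"
    unfolding vec_eq_iff forall_3 grad_def gr
    unfolding cyl_field_def cyl_vec_inner[OF r] \<rho>_def[symmetric]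
      times_divide_eq_right[symmetric] A_def[symmetric] B_def[symmetric] G_def[symmetric] using ab
    by (simp add: axis_def comp) algebra
qed

lemma twist_field_eq: "twist_field R \<beta> = cyl_field R (\<lambda>_. 0) (\<lambda>\<rho>. sin (\<beta> \<rho>)) (\<lambda>\<rho>. cos (\<beta> \<rho>))"
  by (simp add: fun_eq_iff twist_field_def cyl_field_def cyl_vec_def Let_def)

lemma perturbation_eq:
  "perturbation R \<beta> f g = cyl_field R f (\<lambda>\<rho>. - (g \<rho> * cos (\<beta> \<rho>))) (\<lambda>\<rho>. g \<rho> * sin (\<beta> \<rho>))"
  by (simp add: fun_eq_iff perturbation_def cyl_field_def cyl_vec_def Let_def)

section \<open>Pointwise form of the second variation\<close>

text \<open>Completion of the square along the Jacobi field \<open>s\<close>, with \<open>ft\<close>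
  for D f: since D s = w c^2 s, the square containing \<open>w\<close> equals s^2 (D (f/s))^2. The
  last bracket is D (A f^2) with A = 1 - 2 k24 c^2 - k3 s^2 + w c^2.\<close>

lemma radial_part_identity:
  fixes s c w k1 k3 k24 f ft :: real
  assumes sc: "s\<^sup>2 + c\<^sup>2 = 1" and k3: "k3 * s\<^sup>2 = (w\<^sup>2 - 1) * c\<^sup>2"
  defines "b \<equiv> w * s * c"
  shows "(k1 - 2 * k24) * (ft + f)\<^sup>2 - 2 * (b + s * c) * (f\<^sup>2 * (b + s * c))
      + k3 * (f\<^sup>2 * (b\<^sup>2 + 2 * s * c * b + s\<^sup>2) - 2 * s\<^sup>2 * (f\<^sup>2 * s\<^sup>2 + f * ft))
      + 2 * k24 * (ft\<^sup>2 + f\<^sup>2 + 2 * f\<^sup>2 * s * c * b + 2 * s\<^sup>2 * f * ft)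
    = (k1 - 1) * (ft + f)\<^sup>2 + (ft - w * c\<^sup>2 * f)\<^sup>2
      + s\<^sup>2 * ((k3 - 1)\<^sup>2 * s\<^sup>2 + 4 * w * c\<^sup>2 * (k3 - 1)) * f\<^sup>2
      + (2 * (1 - 2 * k24 * c\<^sup>2 - k3 * s\<^sup>2 + w * c\<^sup>2) * f * ft
         + (4 * k24 * s * c * b - 2 * k3 * s * c * b + (w\<^sup>2 - 1) * c\<^sup>2 - 2 * w * s * c * b) * f\<^sup>2)"
  using assms by algebra

text \<open>The factor 2 w c^2 - 1/w is D b / b for the Jacobi field \<open>b\<close>, and the last
  bracket is D (B g^2), with (1 - 2 k24)(2 c^2 - 1) + 2 w c^2 - 1/w as B. Naming the inverse
  \<open>wi\<close> keeps the identity polynomial.\<close>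

lemma tangential_part_identity:
  fixes s c w k3 k24 g gt :: real
  assumes sc: "s\<^sup>2 + c\<^sup>2 = 1" and k3: "k3 * s\<^sup>2 = (w\<^sup>2 - 1) * c\<^sup>2" and wi: "w * wi = 1"
  defines "b \<equiv> w * s * c"
  shows "(gt + g * (c\<^sup>2 - s\<^sup>2))\<^sup>2 - 2 * (b + s * c) * (2 * g\<^sup>2 * s * c)
      + k3 * (4 * g\<^sup>2 * s\<^sup>2 * c\<^sup>2 + s\<^sup>2 * (2 * g\<^sup>2 * (c\<^sup>2 - s\<^sup>2)))
      + 2 * k24 * (- 2 * g * c * (gt * c - g * s * b) + 2 * g\<^sup>2 * s * c * b + 2 * s\<^sup>2 * g * gt)
    = (gt - (2 * w * c\<^sup>2 - wi) * g)\<^sup>2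
      + (2 * ((1 - 2 * k24) * (2 * c\<^sup>2 - 1) + (2 * w * c\<^sup>2 - wi)) * g * gt
         + ((1 - 2 * k24) * (- 4 * s * c * b) + 2 * (w\<^sup>2 - 1) * c\<^sup>2 - 4 * w * s * c * b + (w\<^sup>2 - 1) * wi\<^sup>2) * g\<^sup>2)"
  using assms by algebra

text \<open>Written with \<rho> d/d\<rho>, every first derivative carries exactly one factor 1/r,
  and the density is quadratic in such terms; the factor r^2 clears them all. The profile need not
  be an equilibrium here.\<close>

lemma second_var_density_twist:
  fixes \<beta> f g :: "real \<Rightarrow> real" and x :: "real^3" and R :: real
  defines "\<rho> \<equiv> rad x / R"
  assumes x: "rad x > 0" and R: "R > 0"
    and \<beta>: "(\<beta> has_real_derivative \<beta>1) (at \<rho>)"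
    and f: "(f has_real_derivative f1) (at \<rho>)" and g: "(g has_real_derivative g1) (at \<rho>)"
  defines "s \<equiv> sin (\<beta> \<rho>)" and "c \<equiv> cos (\<beta> \<rho>)" and "b \<equiv> \<rho> * \<beta>1" and "ft \<equiv> \<rho> * f1" and "gt \<equiv> \<rho> * g1"
  shows "(rad x)\<^sup>2 * second_var_density K11 K22 K33 K24 (twist_field R \<beta>) (perturbation R \<beta> f g) x
    = (K11 - 2 * K24) * (ft + f \<rho>)\<^sup>2
      + K22 * ((gt + g \<rho> * (c\<^sup>2 - s\<^sup>2))\<^sup>2 - 2 * (b + s * c) * (2 * (g \<rho>)\<^sup>2 * s * c + (f \<rho>)\<^sup>2 * (b + s * c)))
      + K33 * (4 * (g \<rho>)\<^sup>2 * s\<^sup>2 * c\<^sup>2 + (f \<rho>)\<^sup>2 * (b\<^sup>2 + 2 * s * c * b + s\<^sup>2)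
          + s\<^sup>2 * (2 * (g \<rho>)\<^sup>2 * (c\<^sup>2 - s\<^sup>2) - 2 * (f \<rho>)\<^sup>2 * s\<^sup>2 - 2 * f \<rho> * ft))
      + 2 * K24 * (ft\<^sup>2 + (f \<rho>)\<^sup>2 - 2 * g \<rho> * c * (gt * c - g \<rho> * s * b)
          + 2 * ((f \<rho>)\<^sup>2 + (g \<rho>)\<^sup>2) * s * c * b + 2 * s\<^sup>2 * (f \<rho> * ft + g \<rho> * gt))"
proof -
  define i where "i = 1 / rad x"
  define F G where "F = f \<rho>" and "G = g \<rho>"
  have i: "rad x * i = 1" using x by (simp add: i_def)
  have R1: "y / R = \<rho> * y * i" "y / rad x = y * i" for y using x R by (simp_all add: \<rho>_def i_def)
  have sc: "s\<^sup>2 + c\<^sup>2 = 1" by (simp add: s_def c_def)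
  have dz: "((\<lambda>_. 0) has_real_derivative 0) (at \<rho>)" by simp
  have ds: "((\<lambda>\<rho>. sin (\<beta> \<rho>)) has_real_derivative c * \<beta>1) (at \<rho>)"
    and dc: "((\<lambda>\<rho>. cos (\<beta> \<rho>)) has_real_derivative - s * \<beta>1) (at \<rho>)"
    using \<beta> by (auto intro!: derivative_eq_intros simp: s_def c_def)
  have dgc: "((\<lambda>\<rho>. - (g \<rho> * cos (\<beta> \<rho>))) has_real_derivative - (g1 * c - G * s * \<beta>1)) (at \<rho>)"
    and dgs: "((\<lambda>\<rho>. g \<rho> * sin (\<beta> \<rho>)) has_real_derivative g1 * s + G * c * \<beta>1) (at \<rho>)"
    using \<beta> g by (auto intro!: derivative_eq_intros simp: s_def c_def G_def algebra_simps)
  note n = differential_operators_cyl_field[OF x dz[unfolded \<rho>_def] ds[unfolded \<rho>_def] dc[unfolded \<rho>_def],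
      folded twist_field_eq \<rho>_def, folded s_def c_def, unfolded R1]
  note v = differential_operators_cyl_field[OF x f[unfolded \<rho>_def] dgc[unfolded \<rho>_def] dgs[unfolded \<rho>_def],
      folded perturbation_eq \<rho>_def, folded s_def c_def F_def G_def, unfolded R1]
  have N: "twist_field R \<beta> x = cyl_vec x 0 s c"
    unfolding twist_field_eq cyl_field_def by (simp add: s_def c_def \<rho>_def)
  have V: "perturbation R \<beta> f g x = cyl_vec x F (- (G * c)) (G * s)"
    unfolding perturbation_eq cyl_field_def by (simp add: s_def c_def \<rho>_def F_def G_def)
  have dn: "divg (twist_field R \<beta>) x = 0" unfolding n by simp
  have dv: "divg (perturbation R \<beta> f g) x = (ft + F) * i" unfolding v by (simp add: ft_def algebra_simps)
  have cn: "curl (twist_field R \<beta>) x = cyl_vec x 0 (s * b * i) ((c * b + s) * i)"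
    unfolding n by (simp add: b_def algebra_simps)
  have cv: "curl (perturbation R \<beta> f g) x
      = cyl_vec x 0 (- (gt * s + G * c * b) * i) ((- (gt * c) + G * s * b - G * c) * i)"
    unfolding v by (simp add: b_def gt_def algebra_simps)
  have tn: "tr_sq (twist_field R \<beta>) x = - 2 * s * c * b * i\<^sup>2"
    unfolding n by (simp add: b_def power2_eq_square)
  have tv: "tr_sq (perturbation R \<beta> f g) x = (ft\<^sup>2 + F\<^sup>2 - 2 * G * c * (gt * c - G * s * b)) * i\<^sup>2"
    unfolding v by (simp add: b_def ft_def gt_def power2_eq_square algebra_simps)
  have gv: "grad (\<lambda>y. perturbation R \<beta> f g y \<bullet> perturbation R \<beta> f g y) x = cyl_vec x (2 * (F * ft + G * gt) * i) 0 0"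
  proof -
    \<comment> \<open>The terms with \<open>\<beta>1\<close> cancel, as they must, because |v|^2 =
      f^2 + g^2.\<close>
    have "2 * (\<rho> * (F * f1) * i + \<rho> * (- (G * c) * - (g1 * c - G * s * \<beta>1)) * i + \<rho> * (G * s * (g1 * s + G * c * \<beta>1)) * i)
       = 2 * (F * ft + G * gt) * i"
      unfolding ft_def gt_def using sc by algebra
    then show ?thesis unfolding v by simp
  qed
  have VV: "cyl_vec x F (- (G * c)) (G * s) \<bullet> cyl_vec x F (- (G * c)) (G * s) = F\<^sup>2 + G\<^sup>2"
    unfolding cyl_vec_inner[OF x] using sc by algebra
  have Ncn: "cyl_vec x 0 s c \<bullet> cyl_vec x 0 (s * b * i) ((c * b + s) * i) = (b + s * c) * i"
    unfolding cyl_vec_inner[OF x] using sc by algebra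
  have Vcn: "cyl_vec x F (- (G * c)) (G * s) \<bullet> cyl_vec x 0 (s * b * i) ((c * b + s) * i)
      + cyl_vec x 0 s c \<bullet> cyl_vec x 0 (- (gt * s + G * c * b) * i) ((- (gt * c) + G * s * b - G * c) * i)
     = - (gt + G * (c\<^sup>2 - s\<^sup>2)) * i"
    unfolding cyl_vec_inner[OF x] using sc by algebra
  have Vcv: "cyl_vec x F (- (G * c)) (G * s) \<bullet> cyl_vec x 0 (- (gt * s + G * c * b) * i) ((- (gt * c) + G * s * b - G * c) * i)
     = (G\<^sup>2 * b - G\<^sup>2 * s * c) * i"
    unfolding cyl_vec_inner[OF x] using sc by algebra
  have Tn: "cyl_vec x 0 s c \<times> cyl_vec x 0 (s * b * i) ((c * b + s) * i) = cyl_vec x (s\<^sup>2 * i) 0 0"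
  proof -
    have "s * ((c * b + s) * i) - c * (s * b * i) = s\<^sup>2 * i" by algebra
    then show ?thesis unfolding cyl_vec_cross[OF x] by simp
  qed
  have Tv: "cyl_vec x F (- (G * c)) (G * s) \<times> cyl_vec x 0 (s * b * i) ((c * b + s) * i)
       + cyl_vec x 0 s c \<times> cyl_vec x 0 (- (gt * s + G * c * b) * i) ((- (gt * c) + G * s * b - G * c) * i)
     = cyl_vec x (- (2 * G * s * c) * i) (- F * (c * b + s) * i) (F * s * b * i)"
  proof -
    have "- (G * c) * ((c * b + s) * i) - G * s * (s * b * i)
        + (s * ((- (gt * c) + G * s * b - G * c) * i) - c * (- (gt * s + G * c * b) * i)) = - (2 * G * s * c) * i"
      by (simp add: algebra_simps power2_eq_square)
    then show ?thesis unfolding cyl_vec_cross[OF x] cyl_vec_linear by (simp add: algebra_simps)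
  qed
  have norm: "(norm (cyl_vec x (- (2 * G * s * c) * i) (- F * (c * b + s) * i) (F * s * b * i)))\<^sup>2
     = (4 * G\<^sup>2 * s\<^sup>2 * c\<^sup>2 + F\<^sup>2 * (b\<^sup>2 + 2 * s * c * b + s\<^sup>2)) * i\<^sup>2"
    unfolding power2_norm_eq_inner cyl_vec_inner[OF x] using sc by algebra
  have Tvv: "cyl_vec x (s\<^sup>2 * i) 0 0 \<bullet> (2 *\<^sub>R (cyl_vec x F (- (G * c)) (G * s) \<times> cyl_vec x 0 (- (gt * s + G * c * b) * i) ((- (gt * c) + G * s * b - G * c) * i))
       - (2 * (F\<^sup>2 + G\<^sup>2)) *\<^sub>R cyl_vec x (s\<^sup>2 * i) 0 0 - cyl_vec x (2 * (F * ft + G * gt) * i) 0 0)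
     = s\<^sup>2 * (2 * G\<^sup>2 * (c\<^sup>2 - s\<^sup>2) - 2 * F\<^sup>2 * s\<^sup>2 - 2 * F * ft) * i\<^sup>2"
    unfolding cyl_vec_cross[OF x] cyl_vec_linear cyl_vec_inner[OF x] using sc by algebra
  have Ng: "cyl_vec x 0 s c \<bullet> cyl_vec x (2 * (F * ft + G * gt) * i) 0 0 = 0"
    and Tg: "cyl_vec x (s\<^sup>2 * i) 0 0 \<bullet> cyl_vec x (2 * (F * ft + G * gt) * i) 0 0 = 2 * s\<^sup>2 * (F * ft + G * gt) * i\<^sup>2"
    unfolding cyl_vec_inner[OF x] by (simp_all add: power2_eq_square)
  have i2: "(rad x)\<^sup>2 * (y * i\<^sup>2) = y" for y using i by algebra
  show ?thesis
    apply (rule trans[OF _ i2], rule arg_cong[where f = "\<lambda>y. (rad x)\<^sup>2 * y"])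
    unfolding second_var_density_def Let_def N V dn dv cn cv tn tv gv VV Vcn Vcv Ncn Tn Tv norm Tvv Ng Tg
      F_def[symmetric] G_def[symmetric]
    by (simp add: algebra_simps power2_eq_square)
qed

section \<open>The escaped-twist profile\<close>

text \<open>\<open>w\<close> is the logarithmic derivative \<rho> T'/T of the tangent
  \<open>T\<close>, so \<rho> d/d\<rho> of arctan T is w T/(1 + T^2), which is w s c. The relation
  with \<open>k3\<close> is E^2 - D^2 = q^2 \<rho>^2 for numerator and denominator of
  \<open>w\<close>. The sign \<open>\<sigma>\<close> treats both branches at once.\<close>

lemma ET_profile:
  fixes k3 k24 :: real and \<beta> w :: "real \<Rightarrow> real"
  assumes k3: "k3 > 0" and k24: "k24 > 1"
    and \<beta>: "\<beta> = beta_ET k3 k24 \<or> \<beta> = (\<lambda>\<rho>. - beta_ET k3 k24 \<rho>)"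
    and w_def: "w = (\<lambda>\<rho>. (k24 + (k24 - 1) * \<rho>\<^sup>2) / (k24 - (k24 - 1) * \<rho>\<^sup>2))"
  obtains \<beta>1 w1 where "\<beta> \<in> borel_measurable borel" "w \<in> borel_measurable borel"
    and "continuous_on {0..1} \<beta>1" "continuous_on {0..1} w1"
    and "\<And>\<rho>. \<rho> \<in> {0..1} \<Longrightarrow> (\<beta> has_real_derivative \<beta>1 \<rho>) (at \<rho>)"
    and "\<And>\<rho>. \<rho> \<in> {0..1} \<Longrightarrow> (w has_real_derivative w1 \<rho>) (at \<rho>)"
    and "\<And>\<rho>. \<rho> \<in> {0..1} \<Longrightarrow> w \<rho> \<ge> 1"
    and "\<And>\<rho>. \<rho> \<in> {0..1} \<Longrightarrow> \<rho> * \<beta>1 \<rho> = w \<rho> * sin (\<beta> \<rho>) * cos (\<beta> \<rho>)"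
    and "\<And>\<rho>. \<rho> \<in> {0..1} \<Longrightarrow> \<rho> * w1 \<rho> = (w \<rho>)\<^sup>2 - 1"
    and "\<And>\<rho>. \<rho> \<in> {0..1} \<Longrightarrow> k3 * (sin (\<beta> \<rho>))\<^sup>2 = ((w \<rho>)\<^sup>2 - 1) * (cos (\<beta> \<rho>))\<^sup>2"
    and "\<And>\<rho>. \<rho> \<in> {0..1} \<Longrightarrow> cos (\<beta> \<rho>) \<noteq> 0"
    and "\<And>\<rho>. \<rho> \<in> {0<..1} \<Longrightarrow> sin (\<beta> \<rho>) \<noteq> 0"
    and "w 1 = 2 * k24 - 1"
proof -
  obtain \<sigma> :: real where \<sigma>: "\<sigma> = 1 \<or> \<sigma> = -1" and \<beta>\<sigma>: "\<beta> = (\<lambda>\<rho>. \<sigma> * beta_ET k3 k24 \<rho>)"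
    using \<beta> that by (metis (no_types, lifting) ext mult_1 mult_minus1)
  define q where "q = 2 * sqrt (k24 * (k24 - 1))"
  define D where "D = (\<lambda>\<rho>. k24 - (k24 - 1) * \<rho>\<^sup>2)"
  define E where "E = (\<lambda>\<rho>. k24 + (k24 - 1) * \<rho>\<^sup>2)"
  define T where "T = (\<lambda>\<rho>. q * \<rho> / (sqrt k3 * D \<rho>))"
  have w: "w \<rho> = E \<rho> / D \<rho>" for \<rho> by (simp add: w_def E_def D_def)
  have \<beta>T: "\<beta> \<rho> = \<sigma> * arctan (T \<rho>)" for \<rho>
    by (simp add: \<beta>\<sigma> beta_ET_def T_def q_def D_def)
  have q: "q > 0" "q\<^sup>2 = 4 * (k24 * (k24 - 1))" using k24 by (simp_all add: q_def power_mult_distrib)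
  have sk: "sqrt k3 > 0" "(sqrt k3)\<^sup>2 = k3" using k3 by simp_all
  have D: "D \<rho> > 0" if "\<rho> \<in> {0..1}" for \<rho>
  proof -
    have "\<rho>\<^sup>2 \<le> 1" using that by (simp add: power_le_one)
    then have "(k24 - 1) * \<rho>\<^sup>2 \<le> (k24 - 1) * 1" using k24 by (intro mult_left_mono) auto
    then show ?thesis by (simp add: D_def)
  qed
  define T1 where "T1 = (\<lambda>\<rho>. q * E \<rho> / (sqrt k3 * (D \<rho>)\<^sup>2))"
  define w1 where "w1 = (\<lambda>\<rho>. 4 * k24 * (k24 - 1) * \<rho> / (D \<rho>)\<^sup>2)"
  define \<beta>1 where "\<beta>1 = (\<lambda>\<rho>. \<sigma> * (T1 \<rho> / (1 + (T \<rho>)\<^sup>2)))"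
  have T1: "(T has_real_derivative T1 \<rho>) (at \<rho>)" if "\<rho> \<in> {0..1}" for \<rho>
    unfolding T_def T1_def using D[OF that] sk(1)
    by (auto intro!: derivative_eq_intros simp: D_def E_def divide_simps) (auto simp: algebra_simps power2_eq_square)
  have w1: "(w has_real_derivative w1 \<rho>) (at \<rho>)" if "\<rho> \<in> {0..1}" for \<rho>
    unfolding w_def w1_def using D[OF that]
    by (auto intro!: derivative_eq_intros simp: D_def divide_simps) (auto simp: algebra_simps power2_eq_square)
  have pos: "1 + (T \<rho>)\<^sup>2 \<noteq> 0" for \<rho> by (smt (verit) zero_le_power2)
  have cosb: "(cos (\<beta> \<rho>))\<^sup>2 = 1 / (1 + (T \<rho>)\<^sup>2)" and cosnz: "cos (\<beta> \<rho>) \<noteq> 0"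
    and tanb: "sin (\<beta> \<rho>) = \<sigma> * T \<rho> * cos (\<beta> \<rho>)" for \<rho>
  proof -
    have "cos (\<beta> \<rho>) = cos (arctan (T \<rho>))" "sin (\<beta> \<rho>) = \<sigma> * sin (arctan (T \<rho>))"
      using \<sigma> by (auto simp: \<beta>T)
    then show "(cos (\<beta> \<rho>))\<^sup>2 = 1 / (1 + (T \<rho>)\<^sup>2)" "cos (\<beta> \<rho>) \<noteq> 0" "sin (\<beta> \<rho>) = \<sigma> * T \<rho> * cos (\<beta> \<rho>)"
      using pos[of \<rho>] by (auto simp: cos_arctan sin_arctan power_divide)
  qed
  have kT: "k3 * (T \<rho>)\<^sup>2 = (w \<rho>)\<^sup>2 - 1" and TT: "\<rho> * T1 \<rho> = w \<rho> * T \<rho>" if "\<rho> \<in> {0..1}" for \<rho>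
  proof -
    have "k3 * (T \<rho>)\<^sup>2 = q\<^sup>2 * \<rho>\<^sup>2 / (D \<rho>)\<^sup>2"
      using sk k3 by (simp add: T_def power_divide power_mult_distrib)
    also have "\<dots> = ((E \<rho>)\<^sup>2 - (D \<rho>)\<^sup>2) / (D \<rho>)\<^sup>2"
      unfolding q by (simp add: E_def D_def algebra_simps power2_eq_square)
    finally show "k3 * (T \<rho>)\<^sup>2 = (w \<rho>)\<^sup>2 - 1" using D[OF that] by (simp add: w power_divide diff_divide_distrib)
    show "\<rho> * T1 \<rho> = w \<rho> * T \<rho>" by (simp add: T1_def T_def w power2_eq_square mult_ac)
  qed
  show thesis
  proof (rule that[of \<beta>1 w1])
    have "T \<in> borel_measurable borel" unfolding T_def D_def by measurable
    then show "\<beta> \<in> borel_measurable borel" unfolding \<beta>T[abs_def] by measurable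
    show "w \<in> borel_measurable borel" unfolding w_def by measurable
    have Dc: "continuous_on {0..1} D" "continuous_on {0..1} E"
      unfolding D_def E_def by (auto intro!: continuous_intros)
    show "continuous_on {0..1} w1"
      unfolding w1_def using D Dc by (intro continuous_intros) (auto simp: less_imp_neq[symmetric])
    show "continuous_on {0..1} \<beta>1"
      unfolding \<beta>1_def T1_def T_def using D Dc sk pos[unfolded T_def]
      by (intro continuous_intros) (auto simp: less_imp_neq[symmetric])
    fix \<rho> :: real assume \<rho>: "\<rho> \<in> {0..1}"
    show "(\<beta> has_real_derivative \<beta>1 \<rho>) (at \<rho>)"
      unfolding \<beta>T[abs_def] \<beta>1_def using T1[OF \<rho>]
      by (auto intro!: derivative_eq_intros simp: divide_inverse)
    show "(w has_real_derivative w1 \<rho>) (at \<rho>)" by (rule w1[OF \<rho>])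
    show "w \<rho> \<ge> 1" using D[OF \<rho>] k24 by (simp add: w le_divide_eq) (simp add: E_def D_def)
    show "\<rho> * \<beta>1 \<rho> = w \<rho> * sin (\<beta> \<rho>) * cos (\<beta> \<rho>)"
    proof -
      have "\<rho> * \<beta>1 \<rho> = \<sigma> * (\<rho> * T1 \<rho>) * (1 / (1 + (T \<rho>)\<^sup>2))" by (simp add: \<beta>1_def)
      also have "\<dots> = \<sigma> * (w \<rho> * T \<rho>) * (cos (\<beta> \<rho>))\<^sup>2" unfolding TT[OF \<rho>] cosb ..
      finally show ?thesis unfolding tanb by (simp add: power2_eq_square)
    qed
    show "\<rho> * w1 \<rho> = (w \<rho>)\<^sup>2 - 1"
    proof -
      have "(E \<rho>)\<^sup>2 - (D \<rho>)\<^sup>2 = 4 * k24 * (k24 - 1) * \<rho> * \<rho>"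
        by (simp add: E_def D_def algebra_simps power2_eq_square)
      then show ?thesis using D[OF \<rho>] by (simp add: w1_def w power_divide field_simps)
    qed
    have "(sin (\<beta> \<rho>))\<^sup>2 = (T \<rho>)\<^sup>2 * (cos (\<beta> \<rho>))\<^sup>2"
      using \<sigma> unfolding tanb[of \<rho>] by (auto simp: power_mult_distrib)
    then show "k3 * (sin (\<beta> \<rho>))\<^sup>2 = ((w \<rho>)\<^sup>2 - 1) * (cos (\<beta> \<rho>))\<^sup>2"
      using kT[OF \<rho>] by (metis mult.assoc)
    show "cos (\<beta> \<rho>) \<noteq> 0" by (rule cosnz)
  next
    fix \<rho> :: real assume \<rho>: "\<rho> \<in> {0<..1}"
    then have "T \<rho> \<noteq> 0" using D[of \<rho>] q sk by (simp add: T_def)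
    then show "sin (\<beta> \<rho>) \<noteq> 0" using \<sigma> cosnz tanb[of \<rho>] by auto
  next
    show "w 1 = 2 * k24 - 1" by (simp add: w_def)
  qed
qed

section \<open>Positivity of the second variation\<close>

text \<open>\<open>S\<close> need not be integrable. The negative part of \<open>\<Phi>\<close> is
  bounded by |H|, so an infinite positive part gives the value \<infinity>; otherwise
  \<open>S\<close> is integrable too and the ordinary integrals add up.\<close>

lemma ext_integral_pos:
  fixes \<Phi> S H :: "real \<Rightarrow> real"
  assumes [measurable]: "\<Phi> \<in> borel_measurable M" "S \<in> borel_measurable M"
    and eq: "AE x in M. \<Phi> x = S x + H x" and S: "\<And>x. S x \<ge> 0"
    and H: "integrable M H" "integral\<^sup>L M H \<ge> 0"
    and strict: "integral\<^sup>L M H = 0 \<Longrightarrow> \<not> (AE x in M. S x = 0)"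
  shows "(\<integral>\<^sup>+ x. ennreal (- \<Phi> x) \<partial>M) < \<infinity>" and "ext_integral M \<Phi> > 0"
proof -
  let ?P = "\<integral>\<^sup>+ x. ennreal (\<Phi> x) \<partial>M" and ?N = "\<integral>\<^sup>+ x. ennreal (- \<Phi> x) \<partial>M"
  have "?N \<le> (\<integral>\<^sup>+ x. ennreal (norm (H x)) \<partial>M)"
  proof (rule nn_integral_mono_AE)
    show "AE x in M. ennreal (- \<Phi> x) \<le> ennreal (norm (H x))"
      using eq
    proof eventually_elim
      case (elim x)
      then show ?case using S[of x] by (intro ennreal_leI) simp
    qed
  qed
  also have "\<dots> < \<infinity>" using H(1) by (simp add: integrable_iff_bounded)
  finally show N: "?N < \<infinity>" .
  show "ext_integral M \<Phi> > 0"
  proof (cases "?P = \<infinity>")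
    case True
    then show ?thesis using N unfolding ext_integral_def
      by (cases "\<integral>\<^sup>+ x. ennreal (- \<Phi> x) \<partial>M") auto
  next
    case False
    then have int: "integrable M \<Phi>" using N by (simp add: real_integrable_def top.not_eq_extremum)
    have intS: "integrable M S"
    proof (rule integrable_cong_AE_imp)
      show "integrable M (\<lambda>x. \<Phi> x - H x)" using int H(1) by simp
    qed (use eq in auto)
    have "integral\<^sup>L M \<Phi> = integral\<^sup>L M S + integral\<^sup>L M H"
      using integral_cong_AE[of \<Phi> M "\<lambda>x. S x + H x"] eq intS H(1) by simp
    moreover have "integral\<^sup>L M S \<ge> 0" using S by (simp add: integral_nonneg_AE)
    moreover have "integral\<^sup>L M S \<noteq> 0" if "integral\<^sup>L M H = 0"
      using strict[OF that] integral_nonneg_eq_0_iff_AE[OF intS] S by simp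
    ultimately have "integral\<^sup>L M \<Phi> > 0" using H(2) by (cases "integral\<^sup>L M H = 0") auto
    then have "enn2real ?N < enn2real ?P" using real_lebesgue_integral_def[OF int] by simp
    then show ?thesis using False N unfolding ext_integral_def
      by (cases ?P; cases ?N) auto
  qed
qed

lemma borel_measurable_lebesgue_AE_cong:
  fixes F G :: "'a::euclidean_space \<Rightarrow> real"
  assumes F: "F \<in> borel_measurable lebesgue" and eq: "AE x in lebesgue. F x = G x"
  shows "G \<in> borel_measurable lebesgue"
proof (rule measurableI)
  fix A :: "real set" assume A: "A \<in> sets borel"
  show "G -` A \<inter> space lebesgue \<in> sets lebesgue"
  proof (rule completion.in_sets_AE)
    show "F -` A \<inter> space lebesgue \<in> sets lebesgue" using F A by (rule measurable_sets)
    show "AE x in lebesgue. x \<in> F -` A \<inter> space lebesgue \<longleftrightarrow> x \<in> G -` A \<inter> space lebesgue"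
      using eq by eventually_elim auto
  qed auto
qed simp

text \<open>The second variation density has unspecified values where the perturbation is not
  differentiable. Its measurability is obtained from a radial representative that agrees with it
  almost everywhere.\<close>

lemma borel_measurable_lebesgue_on_AE_cong:
  fixes F G :: "'a::euclidean_space \<Rightarrow> real"
  assumes T: "T \<in> sets lebesgue" and F: "F \<in> borel_measurable (lebesgue_on T)"
    and eq: "AE x in lebesgue_on T. F x = G x"
  shows "G \<in> borel_measurable (lebesgue_on T)"
proof -
  have F': "(\<lambda>x. if x \<in> T then F x else 0) \<in> borel_measurable lebesgue"
    using F T by (simp add: borel_measurable_if_I)
  have "AE x in lebesgue. x \<in> T \<longrightarrow> F x = G x"
    using eq T by (subst (asm) AE_restrict_space_iff) auto
  then have "AE x in lebesgue. (if x \<in> T then F x else 0) = (if x \<in> T then G x else 0)"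
    by eventually_elim auto
  then have "(\<lambda>x. if x \<in> T then G x else 0) \<in> borel_measurable lebesgue"
    by (rule borel_measurable_lebesgue_AE_cong[OF F'])
  then show ?thesis using T by (simp add: borel_measurable_if)
qed

text \<open>Composition with the radius calls for Borel functions. So \<open>f\<close> is extended
  by constants outside [0,1], and the derivative is taken as \<open>lim\<close> of difference
  quotients, which is Borel even where they diverge.\<close>

lemma abs_cont_on_borel_derivative:
  assumes f: "abs_cont_on {0..1} f"
  obtains F f1 N where "F \<in> borel_measurable borel" "f1 \<in> borel_measurable borel" "negligible N"
    "\<And>x. x \<in> {0..1} \<Longrightarrow> F x = f x"
    "\<And>x. x \<in> {0<..<1} - N \<Longrightarrow> (f has_real_derivative f1 x) (at x)"
proof -
  define F where "F x = f (max 0 (min 1 x))" for x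
  have "continuous_on UNIV F"
    unfolding F_def by (rule continuous_on_compose2[OF abs_cont_on_imp_continuous_on[OF f]])
      (auto intro!: continuous_intros)
  then have F[measurable]: "F \<in> borel_measurable borel" by (rule borel_measurable_continuous_onI)
  have Ff: "F x = f x" if "x \<in> {0..1}" for x using that by (simp add: F_def)
  define h where "h n = inverse (real (Suc n))" for n
  define f1 where "f1 x = lim (\<lambda>n. (F (x + h n) - F x) / h n)" for x
  have f1: "f1 \<in> borel_measurable borel"
    unfolding f1_def by (rule borel_measurable_lim_metric) measurable
  show thesis
  proof (rule that[OF F f1 abs_cont_on_imp_differentiable_ae[OF f] Ff])
    fix x assume x: "x \<in> {0<..<1} - {x \<in> {0<..<1}. \<not> f differentiable at x}"
    then obtain D where D: "(f has_real_derivative D) (at x)"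
      by (auto simp: real_differentiable_def)
    have "(F has_real_derivative D) (at x)"
      by (rule has_field_derivative_transform_within_open[OF D, of "{0<..<1}"]) (use x Ff in auto)
    then have "((\<lambda>d. (F (x + d) - F x) / d) \<longlongrightarrow> D) (at 0)" by (simp add: DERIV_def)
    moreover have "filterlim h (at 0) sequentially"
      unfolding filterlim_at h_def using LIMSEQ_inverse_real_of_nat by simp
    ultimately have "(\<lambda>n. (F (x + h n) - F x) / h n) \<longlonglongrightarrow> D" by (rule filterlim_compose)
    then show "(f has_real_derivative f1 x) (at x)" using D limI unfolding f1_def by blast
  qed simp
qed

text \<open>\<open>\<psi>\<close> is meant to be the reciprocal of a Jacobi field, singular on the
  axis. On \<open>{x..1}\<close> it is regular, so the product \<open>u \<psi>\<close> is absolutely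
  continuous there with derivative 0 almost everywhere, and it vanishes at 1.\<close>

lemma abs_cont_on_eq_0_if_product_constant:
  assumes u: "abs_cont_on {0..1} u" "u 1 = 0" and N: "negligible N"
    and \<psi>: "\<And>x. x \<in> {0<..1} \<Longrightarrow> (\<psi> has_real_derivative \<psi>1 x) (at x)" "continuous_on {0<..1} \<psi>1"
      "\<And>x. x \<in> {0<..1} \<Longrightarrow> \<psi> x \<noteq> 0"
    and u1: "\<And>x. x \<in> {0<..<1} - N \<Longrightarrow> (u has_real_derivative u1 x) (at x)"
      "\<And>x. x \<in> {0<..<1} - N \<Longrightarrow> u1 x * \<psi> x + u x * \<psi>1 x = 0"
    and x: "x \<in> {0<..1}"
  shows "u x = 0"
proof -
  have ac: "abs_cont_on {x..1} (\<lambda>y. u y * \<psi> y)"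
  proof (rule abs_cont_on_mult)
    show "abs_cont_on {x..1} u" by (rule abs_cont_on_subset[OF u(1)]) (use x in auto)
    show "abs_cont_on {x..1} \<psi>"
      by (rule abs_cont_on_C1[where f' = \<psi>1]) (use x \<psi>(1) in \<open>auto intro: continuous_on_subset[OF \<psi>(2)]\<close>)
  qed
  have N1: "negligible (N \<union> {x, 1})" using N by (simp add: negligible_Un)
  have der: "((\<lambda>y. u y * \<psi> y) has_real_derivative 0) (at y)" if "y \<in> {x..1} - (N \<union> {x, 1})" for y
  proof -
    have y: "y \<in> {0<..<1} - N" "y \<in> {0<..1}" using that x by auto
    show ?thesis using DERIV_mult[OF u1(1)[OF y(1)] \<psi>(1)[OF y(2)]] u1(2)[OF y(1)] by (simp add: mult.commute add.commute)
  qed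
  have "((\<lambda>_. 0) has_integral (u 1 * \<psi> 1 - u x * \<psi> x)) {x..1}"
    by (rule abs_cont_on_has_integral[OF ac _ N1 der]) (use x in auto)
  then have "u 1 * \<psi> 1 - u x * \<psi> x = 0" by (rule has_integral_unique[OF _ has_integral_0])
  then show ?thesis using u(2) \<psi>(3)[OF x] by simp
qed

lemma AE_lborel_notin_negligible:
  fixes N :: "'a::euclidean_space set"
  assumes "negligible N"
  shows "AE x in lborel. x \<notin> N"
proof -
  have "AE x in lebesgue. x \<notin> N" using assms by (intro AE_not_in) (simp add: negligible_iff_null_sets)
  then show ?thesis by (simp add: AE_completion_iff)
qed

lemma AE_lborel_imp_negligible:
  fixes P :: "'a::euclidean_space \<Rightarrow> bool"
  assumes "AE x in lborel. P x"
  shows "negligible {x. \<not> P x}"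
proof -
  obtain N where "N \<in> null_sets lborel" "{x. \<not> P x} \<subseteq> N"
    using assms unfolding eventually_ae_filter by auto
  then show ?thesis
    using negligible_subset negligible_iff_null_sets null_sets_completionI by blast
qed

text \<open>Quasi-integrability belongs to the claim: without it, positivity could be an artefact of
  the convention \<infinity> - \<infinity> = \<infinity>.\<close>

theorem mainTheorem2:
  fixes K11 K22 K33 K24 k1 k3 k24 R L :: real
    and \<beta> f g :: "real \<Rightarrow> real"
  assumes "K22 > 0"
    and "k1 = K11 / K22" and "k3 = K33 / K22" and "k24 = K24 / K22"
    and "k1 \<ge> 1" and "k3 \<ge> 1" and "k24 > 1"
    and "R > 0" and "L > 0"
    and "\<beta> = beta_ET k3 k24 \<or> \<beta> = (\<lambda>\<rho>. - beta_ET k3 k24 \<rho>)"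
    and "abs_cont_on {0..1} f" and "abs_cont_on {0..1} g"
    and "f 0 = 0" and "g 0 = 0" and "f 1 = 0"
    and "\<not> (\<forall>\<rho>\<in>{0..1}. f \<rho> = 0 \<and> g \<rho> = 0)"
  shows "quasi_integrable (lebesgue_on (cylinder R L))
           (second_var_density K11 K22 K33 K24 (twist_field R \<beta>) (perturbation R \<beta> f g))
         \<and> second_variation K11 K22 K33 K24 (cylinder R L)
             (twist_field R \<beta>) (perturbation R \<beta> f g) > 0"
proof -
  note f = \<open>abs_cont_on {0..1} f\<close> and g = \<open>abs_cont_on {0..1} g\<close>
  have K: "K11 = k1 * K22" "K33 = k3 * K22" "K24 = k24 * K22" using assms(1-4) by simp_all
  have "k3 > 0" using \<open>k3 \<ge> 1\<close> by simp

  \<comment> \<open>The profile and Borel representatives of the perturbation\<close>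
  define w where "w = (\<lambda>\<rho>. (k24 + (k24 - 1) * \<rho>\<^sup>2) / (k24 - (k24 - 1) * \<rho>\<^sup>2))"
  obtain \<beta>1 w1 where [measurable]: "\<beta> \<in> borel_measurable borel" "w \<in> borel_measurable borel"
    and cont: "continuous_on {0..1} \<beta>1" "continuous_on {0..1} w1"
    and \<beta>1: "\<And>\<rho>. \<rho> \<in> {0..1} \<Longrightarrow> (\<beta> has_real_derivative \<beta>1 \<rho>) (at \<rho>)"
    and w1: "\<And>\<rho>. \<rho> \<in> {0..1} \<Longrightarrow> (w has_real_derivative w1 \<rho>) (at \<rho>)"
    and w: "\<And>\<rho>. \<rho> \<in> {0..1} \<Longrightarrow> w \<rho> \<ge> 1"
    and \<beta>t: "\<And>\<rho>. \<rho> \<in> {0..1} \<Longrightarrow> \<rho> * \<beta>1 \<rho> = w \<rho> * sin (\<beta> \<rho>) * cos (\<beta> \<rho>)"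
    and wt: "\<And>\<rho>. \<rho> \<in> {0..1} \<Longrightarrow> \<rho> * w1 \<rho> = (w \<rho>)\<^sup>2 - 1"
    and k3s: "\<And>\<rho>. \<rho> \<in> {0..1} \<Longrightarrow> k3 * (sin (\<beta> \<rho>))\<^sup>2 = ((w \<rho>)\<^sup>2 - 1) * (cos (\<beta> \<rho>))\<^sup>2"
    and cosnz: "\<And>\<rho>. \<rho> \<in> {0..1} \<Longrightarrow> cos (\<beta> \<rho>) \<noteq> 0"
    and sinnz: "\<And>\<rho>. \<rho> \<in> {0<..1} \<Longrightarrow> sin (\<beta> \<rho>) \<noteq> 0"
    and w_1: "w 1 = 2 * k24 - 1"
    by (rule ET_profile[OF \<open>k3 > 0\<close> \<open>k24 > 1\<close> assms(10) w_def]) (rule that; assumption)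
  obtain F f1 Nf where Fm[measurable]: "F \<in> borel_measurable borel" "f1 \<in> borel_measurable borel"
    and Nf: "negligible Nf" and F: "\<And>x. x \<in> {0..1} \<Longrightarrow> F x = f x"
    and f1: "\<And>x. x \<in> {0<..<1} - Nf \<Longrightarrow> (f has_real_derivative f1 x) (at x)"
    using abs_cont_on_borel_derivative[OF f] by blast
  obtain G g1 Ng where Gm[measurable]: "G \<in> borel_measurable borel" "g1 \<in> borel_measurable borel"
    and Ng: "negligible Ng" and G: "\<And>x. x \<in> {0..1} \<Longrightarrow> G x = g x"
    and g1: "\<And>x. x \<in> {0<..<1} - Ng \<Longrightarrow> (g has_real_derivative g1 x) (at x)"
    using abs_cont_on_borel_derivative[OF g] by blast
  define N where "N = Nf \<union> Ng"
  have N: "negligible N" using Nf Ng by (simp add: N_def negligible_Un)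

  \<comment> \<open>Coefficients, squares and exact part\<close>
  define s c where "s \<rho> = sin (\<beta> \<rho>)" and "c \<rho> = cos (\<beta> \<rho>)" for \<rho>
  have sc: "(s \<rho>)\<^sup>2 + (c \<rho>)\<^sup>2 = 1" for \<rho> by (simp add: s_def c_def)
  have [measurable]: "s \<in> borel_measurable borel" "c \<in> borel_measurable borel"
    unfolding s_def c_def by measurable
  define b where "b \<rho> = w \<rho> * s \<rho> * c \<rho>" for \<rho>
  have [measurable]: "b \<in> borel_measurable borel" unfolding b_def by measurable
  define p where "p \<rho> = 2 * w \<rho> * (c \<rho>)\<^sup>2 - inverse (w \<rho>)" for \<rho>
  \<comment> \<open>\<open>At\<close>, \<open>Bt\<close>, \<open>ht\<close> are \<open>\<rho>\<close> times the derivatives \<open>A1\<close>, \<open>B1\<close> and that of \<open>h\<close>, written without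
    \<open>\<beta>1\<close> and \<open>w1\<close> so that they are visibly Borel.\<close>
  define A where "A \<rho> = 1 - 2 * k24 * (c \<rho>)\<^sup>2 - k3 * (s \<rho>)\<^sup>2 + w \<rho> * (c \<rho>)\<^sup>2" for \<rho>
  define B where "B \<rho> = (1 - 2 * k24) * (2 * (c \<rho>)\<^sup>2 - 1) + p \<rho>" for \<rho>
  define At where "At \<rho> = 4 * k24 * s \<rho> * c \<rho> * b \<rho> - 2 * k3 * s \<rho> * c \<rho> * b \<rho>
      + ((w \<rho>)\<^sup>2 - 1) * (c \<rho>)\<^sup>2 - 2 * w \<rho> * s \<rho> * c \<rho> * b \<rho>" for \<rho>
  define Bt where "Bt \<rho> = (1 - 2 * k24) * (- 4 * s \<rho> * c \<rho> * b \<rho>) + 2 * ((w \<rho>)\<^sup>2 - 1) * (c \<rho>)\<^sup>2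
      - 4 * w \<rho> * s \<rho> * c \<rho> * b \<rho> + ((w \<rho>)\<^sup>2 - 1) * (inverse (w \<rho>))\<^sup>2" for \<rho>
  have [measurable]: "p \<in> borel_measurable borel" unfolding p_def by measurable
  have [measurable]: "A \<in> borel_measurable borel" "B \<in> borel_measurable borel"
    "At \<in> borel_measurable borel" "Bt \<in> borel_measurable borel"
    unfolding A_def B_def At_def Bt_def by measurable
  define sq where "sq \<rho> = (k1 - 1) * (\<rho> * f1 \<rho> + F \<rho>)\<^sup>2 + (\<rho> * f1 \<rho> - w \<rho> * (c \<rho>)\<^sup>2 * F \<rho>)\<^sup>2
      + (s \<rho>)\<^sup>2 * ((k3 - 1)\<^sup>2 * (s \<rho>)\<^sup>2 + 4 * w \<rho> * (c \<rho>)\<^sup>2 * (k3 - 1)) * (F \<rho>)\<^sup>2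
      + (\<rho> * g1 \<rho> - p \<rho> * G \<rho>)\<^sup>2" for \<rho>
  define ht where "ht \<rho> = 2 * A \<rho> * F \<rho> * (\<rho> * f1 \<rho>) + At \<rho> * (F \<rho>)\<^sup>2
      + (2 * B \<rho> * G \<rho> * (\<rho> * g1 \<rho>) + Bt \<rho> * (G \<rho>)\<^sup>2)" for \<rho>
  \<comment> \<open>The denominator is r^2; at \<rho> = 0 division by zero yields 0.\<close>
  define D where "D \<rho> = K22 * (sq \<rho> + ht \<rho>) / (R * \<rho>)\<^sup>2" for \<rho>
  have [measurable]: "sq \<in> borel_measurable borel" "ht \<in> borel_measurable borel"
    unfolding sq_def ht_def by measurable
  have [measurable]: "D \<in> borel_measurable borel" unfolding D_def by measurable

  \<comment> \<open>The density as a function of the scaled radius\<close>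
  have density: "second_var_density K11 K22 K33 K24 (twist_field R \<beta>) (perturbation R \<beta> f g) x = D (rad x / R)"
    if x: "rad x / R \<in> {0<..<1} - N" for x
  proof -
    define \<rho> where "\<rho> = rad x / R"
    have \<rho>: "\<rho> \<in> {0<..<1} - N" "\<rho> \<in> {0..1}" using x by (auto simp: \<rho>_def)
    have r: "rad x > 0" "rad x = R * \<rho>"
      using \<rho> \<open>R > 0\<close> by (auto simp: \<rho>_def zero_less_divide_iff)
    have df: "(f has_real_derivative f1 \<rho>) (at \<rho>)" and dg: "(g has_real_derivative g1 \<rho>) (at \<rho>)"
      using f1 g1 \<rho> by (auto simp: N_def)
    have b: "\<rho> * \<beta>1 \<rho> = b \<rho>" using \<beta>t[OF \<rho>(2)] by (simp add: b_def s_def c_def)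
    have k3s': "k3 * (s \<rho>)\<^sup>2 = ((w \<rho>)\<^sup>2 - 1) * (c \<rho>)\<^sup>2" using k3s[OF \<rho>(2)] by (simp add: s_def c_def)
    have wi: "w \<rho> * inverse (w \<rho>) = 1" using w[OF \<rho>(2)] by simp
    define ft gt where "ft = \<rho> * f1 \<rho>" and "gt = \<rho> * g1 \<rho>"
    note den = second_var_density_twist[OF r(1) \<open>R > 0\<close> \<beta>1[OF \<rho>(2), unfolded \<rho>_def]
        df[unfolded \<rho>_def] dg[unfolded \<rho>_def], of K11 K22 K33 K24, folded \<rho>_def, folded s_def c_def, unfolded b,
        folded ft_def gt_def]
    note rp = radial_part_identity[OF sc k3s', of k1 k24 ft "F \<rho>", folded b_def]
    note tp = tangential_part_identity[OF sc k3s' wi, of gt "G \<rho>" k24, folded b_def]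
    let ?LF = "(k1 - 2 * k24) * (ft + F \<rho>)\<^sup>2 - 2 * (b \<rho> + s \<rho> * c \<rho>) * ((F \<rho>)\<^sup>2 * (b \<rho> + s \<rho> * c \<rho>))
      + k3 * ((F \<rho>)\<^sup>2 * ((b \<rho>)\<^sup>2 + 2 * s \<rho> * c \<rho> * b \<rho> + (s \<rho>)\<^sup>2) - 2 * (s \<rho>)\<^sup>2 * ((F \<rho>)\<^sup>2 * (s \<rho>)\<^sup>2 + F \<rho> * ft))
      + 2 * k24 * (ft\<^sup>2 + (F \<rho>)\<^sup>2 + 2 * (F \<rho>)\<^sup>2 * s \<rho> * c \<rho> * b \<rho> + 2 * (s \<rho>)\<^sup>2 * F \<rho> * ft)"
    let ?LG = "(gt + G \<rho> * ((c \<rho>)\<^sup>2 - (s \<rho>)\<^sup>2))\<^sup>2 - 2 * (b \<rho> + s \<rho> * c \<rho>) * (2 * (G \<rho>)\<^sup>2 * s \<rho> * c \<rho>)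
      + k3 * (4 * (G \<rho>)\<^sup>2 * (s \<rho>)\<^sup>2 * (c \<rho>)\<^sup>2 + (s \<rho>)\<^sup>2 * (2 * (G \<rho>)\<^sup>2 * ((c \<rho>)\<^sup>2 - (s \<rho>)\<^sup>2)))
      + 2 * k24 * (- 2 * G \<rho> * c \<rho> * (gt * c \<rho> - G \<rho> * s \<rho> * b \<rho>) + 2 * (G \<rho>)\<^sup>2 * s \<rho> * c \<rho> * b \<rho> + 2 * (s \<rho>)\<^sup>2 * G \<rho> * gt)"
    have "sq \<rho> + ht \<rho> =
        ((k1 - 1) * (ft + F \<rho>)\<^sup>2 + (ft - w \<rho> * (c \<rho>)\<^sup>2 * F \<rho>)\<^sup>2
         + (s \<rho>)\<^sup>2 * ((k3 - 1)\<^sup>2 * (s \<rho>)\<^sup>2 + 4 * w \<rho> * (c \<rho>)\<^sup>2 * (k3 - 1)) * (F \<rho>)\<^sup>2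
         + (2 * A \<rho> * F \<rho> * ft + At \<rho> * (F \<rho>)\<^sup>2))
        + ((gt - p \<rho> * G \<rho>)\<^sup>2 + (2 * B \<rho> * G \<rho> * gt + Bt \<rho> * (G \<rho>)\<^sup>2))"
      unfolding sq_def ht_def ft_def gt_def by simp
    also have "\<dots> = ?LF + ?LG"
      unfolding A_def At_def B_def Bt_def p_def rp tp ..
    finally have "K22 * (sq \<rho> + ht \<rho>) = K22 * (?LF + ?LG)" by simp
    also have "\<dots> = (rad x)\<^sup>2 * second_var_density K11 K22 K33 K24 (twist_field R \<beta>) (perturbation R \<beta> f g) x"
      unfolding den unfolding K F[OF \<rho>(2), symmetric] G[OF \<rho>(2), symmetric]
      by (simp add: algebra_simps power2_eq_square)
    finally have "(rad x)\<^sup>2 * second_var_density K11 K22 K33 K24 (twist_field R \<beta>) (perturbation R \<beta> f g) x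
        = K22 * (sq \<rho> + ht \<rho>)" by simp
    moreover have "(rad x)\<^sup>2 \<noteq> 0" using r(1) by simp
    ultimately show ?thesis
      unfolding \<rho>_def[symmetric] D_def r(2)[symmetric] by (metis nonzero_mult_div_cancel_left)
  qed

  \<comment> \<open>Splitting the one-dimensional integrand\<close>
  define C where "C = measure lebesgue (cylinder R L)"
  \<comment> \<open>Radial integration has weight \<open>2 * C * \<rho>\<close>, and \<rho>/(R
    \<rho>)^2 = 1/(R^2 \<rho>).\<close>
  define \<kappa> where "\<kappa> = 2 * C * K22 / R\<^sup>2"
  have "C > 0" unfolding C_def using \<open>R > 0\<close> \<open>L > 0\<close> by (rule measure_cylinder_pos)
  then have \<kappa>: "\<kappa> > 0" using \<open>R > 0\<close> \<open>K22 > 0\<close> by (simp add: \<kappa>_def)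
  define \<Phi> where "\<Phi> \<rho> = 2 * C * \<rho> * D \<rho> * indicator {0..1} \<rho>" for \<rho>
  define S where "S \<rho> = \<kappa> * (sq \<rho> / \<rho>) * indicator {0..1} \<rho>" for \<rho>
  define H where "H \<rho> = \<kappa> * (ht \<rho> / \<rho>) * indicator {0..1} \<rho>" for \<rho>
  define h where "h \<rho> = A \<rho> * (f \<rho> * f \<rho>) + B \<rho> * (g \<rho> * g \<rho>)" for \<rho>
  have [measurable]: "\<Phi> \<in> borel_measurable borel" "S \<in> borel_measurable borel" "H \<in> borel_measurable borel"
    unfolding \<Phi>_def S_def H_def by measurable
  have split: "\<Phi> \<rho> = S \<rho> + H \<rho>" for \<rho>
  proof -
    have "2 * C * \<rho> * (K22 * y / (R * \<rho>)\<^sup>2) = \<kappa> * (y / \<rho>)" for y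
      using \<open>R > 0\<close> by (cases "\<rho> = 0") (simp_all add: \<kappa>_def power2_eq_square)
    then have "2 * C * \<rho> * D \<rho> = \<kappa> * ((sq \<rho> + ht \<rho>) / \<rho>)" unfolding D_def .
    then have "2 * C * \<rho> * D \<rho> = \<kappa> * (sq \<rho> / \<rho>) + \<kappa> * (ht \<rho> / \<rho>)"
      by (simp add: add_divide_distrib distrib_left)
    then show ?thesis unfolding \<Phi>_def S_def H_def by (simp add: distrib_right)
  qed
  have sq_nonneg: "sq \<rho> \<ge> 0" if "\<rho> \<in> {0..1}" for \<rho>
    unfolding sq_def using \<open>k1 \<ge> 1\<close> \<open>k3 \<ge> 1\<close> w[OF that]
    by (intro add_nonneg_nonneg mult_nonneg_nonneg) auto
  have S_nonneg: "S \<rho> \<ge> 0" for \<rho>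
    using sq_nonneg[of \<rho>] \<kappa> by (auto simp: S_def indicator_def)

  \<comment> \<open>Integrating the exact part\<close>
  define A1 where "A1 \<rho> = 4 * k24 * s \<rho> * c \<rho> * \<beta>1 \<rho> - 2 * k3 * s \<rho> * c \<rho> * \<beta>1 \<rho>
      + w1 \<rho> * (c \<rho>)\<^sup>2 - 2 * w \<rho> * s \<rho> * c \<rho> * \<beta>1 \<rho>" for \<rho>
  define B1 where "B1 \<rho> = (1 - 2 * k24) * (- 4 * s \<rho> * c \<rho> * \<beta>1 \<rho>) + 2 * w1 \<rho> * (c \<rho>)\<^sup>2
      - 4 * w \<rho> * s \<rho> * c \<rho> * \<beta>1 \<rho> + w1 \<rho> * (inverse (w \<rho>))\<^sup>2" for \<rho>
  have ds: "(s has_real_derivative c \<rho> * \<beta>1 \<rho>) (at \<rho>)" and dc: "(c has_real_derivative - s \<rho> * \<beta>1 \<rho>) (at \<rho>)"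
    if "\<rho> \<in> {0..1}" for \<rho>
    using \<beta>1[OF that] unfolding s_def c_def by (auto intro!: derivative_eq_intros)
  have dA: "(A has_real_derivative A1 \<rho>) (at \<rho>)" and dB: "(B has_real_derivative B1 \<rho>) (at \<rho>)"
    if \<rho>: "\<rho> \<in> {0..1}" for \<rho>
  proof -
    have "w \<rho> \<noteq> 0" using w[OF \<rho>] by simp
    then show "(A has_real_derivative A1 \<rho>) (at \<rho>)" "(B has_real_derivative B1 \<rho>) (at \<rho>)"
      unfolding A_def B_def p_def A1_def B1_def using ds[OF \<rho>] dc[OF \<rho>] w1[OF \<rho>]
      by (auto intro!: derivative_eq_intros simp: power2_eq_square algebra_simps)
  qed
  have cs: "continuous_on {0..1} s"
    by (intro continuous_at_imp_continuous_on ballI) (rule DERIV_isCont, rule ds)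
  have cc: "continuous_on {0..1} c"
    by (intro continuous_at_imp_continuous_on ballI) (rule DERIV_isCont, rule dc)
  have cw: "continuous_on {0..1} w"
    by (intro continuous_at_imp_continuous_on ballI) (rule DERIV_isCont, rule w1)
  have w0: "\<forall>\<rho>\<in>{0..1}. w \<rho> \<noteq> 0" using w by force
  have "continuous_on {0..1} A1" "continuous_on {0..1} B1"
    unfolding A1_def B1_def using cs cc cw cont w0 by (auto intro!: continuous_intros)
  then have acA: "abs_cont_on {0..1} A" and acB: "abs_cont_on {0..1} B"
    using abs_cont_on_C1[OF dA] abs_cont_on_C1[OF dB] by blast+
  have ach: "abs_cont_on {0..1} h"
    unfolding h_def using f g acA acB by (intro abs_cont_on_add abs_cont_on_mult)
  have N01: "negligible (N \<union> {0, 1})" using N by (simp add: negligible_Un)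
  have dh: "(h has_real_derivative ht \<rho> / \<rho>) (at \<rho>)" if "\<rho> \<in> {0..1} - (N \<union> {0, 1})" for \<rho>
  proof -
    have \<rho>: "\<rho> \<in> {0..1}" "\<rho> \<noteq> 0" using that by auto
    have df: "(f has_real_derivative f1 \<rho>) (at \<rho>)" and dg: "(g has_real_derivative g1 \<rho>) (at \<rho>)"
      using f1[of \<rho>] g1[of \<rho>] that by (auto simp: N_def)
    have b: "b \<rho> = \<rho> * \<beta>1 \<rho>" using \<beta>t[OF \<rho>(1)] by (simp add: b_def s_def c_def)
    have At: "At \<rho> = \<rho> * A1 \<rho>" and Bt: "Bt \<rho> = \<rho> * B1 \<rho>"
      unfolding At_def Bt_def A1_def B1_def b wt[OF \<rho>(1), symmetric] by (simp_all add: algebra_simps)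
    have "(h has_real_derivative (A1 \<rho> * (f \<rho> * f \<rho>) + (f1 \<rho> * f \<rho> + f1 \<rho> * f \<rho>) * A \<rho>
        + (B1 \<rho> * (g \<rho> * g \<rho>) + (g1 \<rho> * g \<rho> + g1 \<rho> * g \<rho>) * B \<rho>))) (at \<rho>)"
      unfolding h_def by (intro DERIV_add DERIV_mult dA[OF \<rho>(1)] dB[OF \<rho>(1)] df dg)
    moreover have "ht \<rho> = \<rho> * (A1 \<rho> * (f \<rho> * f \<rho>) + (f1 \<rho> * f \<rho> + f1 \<rho> * f \<rho>) * A \<rho>
        + (B1 \<rho> * (g \<rho> * g \<rho>) + (g1 \<rho> * g \<rho> + g1 \<rho> * g \<rho>) * B \<rho>))"
      unfolding ht_def At Bt F[OF \<rho>(1)] G[OF \<rho>(1)] by (simp add: algebra_simps power2_eq_square)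
    ultimately show ?thesis using \<rho>(2) by simp
  qed
  have h01: "h 0 = 0" "h 1 = B 1 * (g 1)\<^sup>2"
    using \<open>f 0 = 0\<close> \<open>g 0 = 0\<close> \<open>f 1 = 0\<close> by (simp_all add: h_def power2_eq_square)
  have "((\<lambda>\<rho>. ht \<rho> / \<rho>) has_integral (h 1 - h 0)) {0..1}"
    by (rule abs_cont_on_has_integral[OF ach _ N01 dh]) auto
  then have int: "((\<lambda>\<rho>. ht \<rho> / \<rho>) has_integral (B 1 * (g 1)\<^sup>2)) {0..1}" by (simp add: h01)
  have abs: "(\<lambda>\<rho>. ht \<rho> / \<rho>) absolutely_integrable_on {0..1}"
    by (rule abs_cont_on_absolutely_integrable[OF ach _ N01 dh]) auto
  have Heq: "H = (\<lambda>\<rho>. \<kappa> * (indicator {0..1} \<rho> *\<^sub>R (ht \<rho> / \<rho>)))" by (simp add: H_def fun_eq_iff)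
  have "integrable lebesgue H"
    unfolding Heq using abs by (intro integrable_mult_right) (simp add: set_integrable_def)
  then have intH: "integrable lborel H" by (subst (asm) integrable_completion) simp_all
  have "integral\<^sup>L lborel H = integral\<^sup>L lebesgue H" by (rule integral_completion[symmetric]) simp
  also have "\<dots> = \<kappa> * (B 1 * (g 1)\<^sup>2)"
    unfolding Heq integral_mult_right_zero set_lebesgue_integral_def[symmetric]
      set_lebesgue_integral_eq_integral(2)[OF abs] integral_unique[OF int] ..
  finally have LH: "integral\<^sup>L lborel H = \<kappa> * (B 1 * (g 1)\<^sup>2)" .
  have B1: "B 1 > 0"
  proof -
    \<comment> \<open>With this value the cosines cancel: - w (2 c^2 - 1) + 2 w c^2 = w at \<rho> =
      1.\<close>
    have k: "1 - 2 * k24 = - w 1" using w_1 by simp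
    have "B 1 = w 1 - inverse (w 1)" unfolding B_def p_def k by (simp add: algebra_simps)
    moreover have "w 1 > 1" using w_1 \<open>k24 > 1\<close> by simp
    ultimately show ?thesis using one_less_inverse_iff[of "w 1"] by (simp add: inverse_less_1_iff less_trans[of "inverse (w 1)" 1])
  qed
  have LH_nonneg: "integral\<^sup>L lborel H \<ge> 0" unfolding LH using \<kappa> B1 by simp

  \<comment> \<open>The equality case\<close>
  have strict: "\<not> (AE \<rho> in lborel. S \<rho> = 0)" if "integral\<^sup>L lborel H = 0"
  proof
    assume AE: "AE \<rho> in lborel. S \<rho> = 0"
    have "g 1 = 0" using that unfolding LH using \<kappa> B1 by simp
    define N' where "N' = N \<union> {\<rho>. \<not> S \<rho> = 0}"
    have N': "negligible N'" unfolding N'_def using N AE_lborel_imp_negligible[OF AE] by (rule negligible_Un)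
    have zero: "\<rho> * f1 \<rho> = w \<rho> * (c \<rho>)\<^sup>2 * f \<rho>" "\<rho> * g1 \<rho> = p \<rho> * g \<rho>" if "\<rho> \<in> {0<..<1} - N'" for \<rho>
    proof -
      have \<rho>: "\<rho> \<in> {0..1}" "\<rho> > 0" "S \<rho> = 0" using that by (auto simp: N'_def)
      have "sq \<rho> = 0" using \<rho> \<kappa> by (simp add: S_def)
      moreover have "(k1 - 1) * (\<rho> * f1 \<rho> + F \<rho>)\<^sup>2 \<ge> 0" using \<open>k1 \<ge> 1\<close> by simp
      moreover have "(s \<rho>)\<^sup>2 * ((k3 - 1)\<^sup>2 * (s \<rho>)\<^sup>2 + 4 * w \<rho> * (c \<rho>)\<^sup>2 * (k3 - 1)) * (F \<rho>)\<^sup>2 \<ge> 0"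
        using \<open>k3 \<ge> 1\<close> w[OF \<rho>(1)] by (intro mult_nonneg_nonneg add_nonneg_nonneg) auto
      ultimately have "(\<rho> * f1 \<rho> - w \<rho> * (c \<rho>)\<^sup>2 * F \<rho>)\<^sup>2 = 0" "(\<rho> * g1 \<rho> - p \<rho> * G \<rho>)\<^sup>2 = 0"
        unfolding sq_def by (smt (verit) zero_le_power2)+
      then show "\<rho> * f1 \<rho> = w \<rho> * (c \<rho>)\<^sup>2 * f \<rho>" "\<rho> * g1 \<rho> = p \<rho> * g \<rho>"
        using F[OF \<rho>(1)] G[OF \<rho>(1)] by simp_all
    qed
    have sub: "{0<..1} \<subseteq> {0..1::real}" by auto
    note cont' = continuous_on_subset[OF cs sub] continuous_on_subset[OF cc sub] continuous_on_subset[OF cw sub]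
      continuous_on_subset[OF cont(1) sub] continuous_on_subset[OF cont(2) sub]
    have s0: "s \<rho> \<noteq> 0" "w \<rho> \<noteq> 0" "c \<rho> \<noteq> 0" "b \<rho> \<noteq> 0" if "\<rho> \<in> {0<..1}" for \<rho>
      using that sinnz[of \<rho>] cosnz[of \<rho>] w[of \<rho>] by (auto simp: s_def c_def b_def)
    have b: "b \<rho> = \<rho> * \<beta>1 \<rho>" if "\<rho> \<in> {0..1}" for \<rho> using \<beta>t[OF that] by (simp add: b_def s_def c_def)
    have "f \<rho> = 0" if "\<rho> \<in> {0<..1}" for \<rho>
    \<comment> \<open>The vanishing square says D f = (D s / s) f, so f/s has derivative 0 almost
      everywhere.\<close>
    proof (rule abs_cont_on_eq_0_if_product_constant[OF f \<open>f 1 = 0\<close> N' _ _ _ _ _ that])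
      show "((\<lambda>\<rho>. inverse (s \<rho>)) has_real_derivative - (c \<rho> * \<beta>1 \<rho> * (inverse (s \<rho>))\<^sup>2)) (at \<rho>)"
        if "\<rho> \<in> {0<..1}" for \<rho>
        using s0[OF that] ds[of \<rho>] that by (auto intro!: derivative_eq_intros simp: power2_eq_square)
      show "continuous_on {0<..1} (\<lambda>\<rho>. - (c \<rho> * \<beta>1 \<rho> * (inverse (s \<rho>))\<^sup>2))"
        using cont' s0 by (auto intro!: continuous_intros)
      show "f1 \<rho> * inverse (s \<rho>) + f \<rho> * - (c \<rho> * \<beta>1 \<rho> * (inverse (s \<rho>))\<^sup>2) = 0" if \<rho>: "\<rho> \<in> {0<..<1} - N'" for \<rho>
      proof -
        define y where "y = inverse (s \<rho>)"
        have y: "s \<rho> * y = 1" using s0[of \<rho>] \<rho> by (simp add: y_def)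
        have "\<rho> * \<beta>1 \<rho> = w \<rho> * s \<rho> * c \<rho>" using b[of \<rho>] \<rho> by (simp add: b_def)
        \<comment> \<open>The factor \<open>\<rho>\<close> turns each derivative into a quantity
          known in terms of \<open>w\<close>, \<open>s\<close>, \<open>c\<close>; it is positive and
          is divided out again.\<close>
        then have "\<rho> * (f1 \<rho> * y + f \<rho> * - (c \<rho> * \<beta>1 \<rho> * y\<^sup>2)) = 0"
          using zero(1)[OF \<rho>] y by algebra
        then show ?thesis using \<rho> by (simp add: y_def)
      qed
      show "inverse (s \<rho>) \<noteq> 0" if "\<rho> \<in> {0<..1}" for \<rho> using s0[OF that] by simp
      show "(f has_real_derivative f1 \<rho>) (at \<rho>)" if "\<rho> \<in> {0<..<1} - N'" for \<rho>
        using f1[of \<rho>] that by (auto simp: N'_def N_def)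
    qed
    moreover have "g \<rho> = 0" if "\<rho> \<in> {0<..1}" for \<rho>
    \<comment> \<open>Likewise for g/b, as \<open>p\<close> is D b / b; here g(1) = 0 is not given
      but follows from the vanishing boundary term.\<close>
    proof (rule abs_cont_on_eq_0_if_product_constant[OF g \<open>g 1 = 0\<close> N' _ _ _ _ _ that])
      show "((\<lambda>\<rho>. inverse (b \<rho>)) has_real_derivative
          - ((w1 \<rho> * s \<rho> * c \<rho> + w \<rho> * ((c \<rho>)\<^sup>2 - (s \<rho>)\<^sup>2) * \<beta>1 \<rho>) * (inverse (b \<rho>))\<^sup>2)) (at \<rho>)"
        if "\<rho> \<in> {0<..1}" for \<rho>
      proof -
        have "(b has_real_derivative (w1 \<rho> * s \<rho> * c \<rho> + w \<rho> * ((c \<rho>)\<^sup>2 - (s \<rho>)\<^sup>2) * \<beta>1 \<rho>)) (at \<rho>)"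
          using ds[of \<rho>] dc[of \<rho>] w1[of \<rho>] that unfolding b_def
          by (auto intro!: derivative_eq_intros simp: power2_eq_square algebra_simps)
        then show ?thesis
          using s0[OF that] by (auto intro!: derivative_eq_intros simp: power2_eq_square)
      qed
      show "continuous_on {0<..1} (\<lambda>\<rho>. - ((w1 \<rho> * s \<rho> * c \<rho> + w \<rho> * ((c \<rho>)\<^sup>2 - (s \<rho>)\<^sup>2) * \<beta>1 \<rho>) * (inverse (b \<rho>))\<^sup>2))"
        using cont' s0 unfolding b_def by (auto intro!: continuous_intros)
      show "g1 \<rho> * inverse (b \<rho>) + g \<rho> * - ((w1 \<rho> * s \<rho> * c \<rho> + w \<rho> * ((c \<rho>)\<^sup>2 - (s \<rho>)\<^sup>2) * \<beta>1 \<rho>) * (inverse (b \<rho>))\<^sup>2) = 0"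
        if \<rho>: "\<rho> \<in> {0<..<1} - N'" for \<rho>
      proof -
        define y where "y = inverse (b \<rho>)"
        have y: "w \<rho> * s \<rho> * c \<rho> * y = 1"
          using right_inverse[OF s0(4)[of \<rho>]] \<rho> unfolding y_def b_def by simp
        have wi: "w \<rho> * inverse (w \<rho>) = 1" using s0[of \<rho>] \<rho> by simp
        have "\<rho> * \<beta>1 \<rho> = w \<rho> * s \<rho> * c \<rho>" using b[of \<rho>] \<rho> by (simp add: b_def)
        moreover have "\<rho> * w1 \<rho> = (w \<rho>)\<^sup>2 - 1" using wt[of \<rho>] \<rho> by simp
        moreover have "\<rho> * g1 \<rho> = (2 * w \<rho> * (c \<rho>)\<^sup>2 - inverse (w \<rho>)) * g \<rho>" using zero(2)[OF \<rho>] by (simp add: p_def)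
        ultimately have "\<rho> * (g1 \<rho> * y + g \<rho> * - ((w1 \<rho> * s \<rho> * c \<rho> + w \<rho> * ((c \<rho>)\<^sup>2 - (s \<rho>)\<^sup>2) * \<beta>1 \<rho>) * y\<^sup>2)) = 0"
          using y wi sc[of \<rho>] by algebra
        then show ?thesis using \<rho> by (simp add: y_def)
      qed
      show "inverse (b \<rho>) \<noteq> 0" if "\<rho> \<in> {0<..1}" for \<rho> using s0[OF that] by simp
      show "(g has_real_derivative g1 \<rho>) (at \<rho>)" if "\<rho> \<in> {0<..<1} - N'" for \<rho>
        using g1[of \<rho>] that by (auto simp: N'_def N_def)
    qed
    ultimately have "\<forall>\<rho>\<in>{0..1}. f \<rho> = 0 \<and> g \<rho> = 0"
      using \<open>f 0 = 0\<close> \<open>g 0 = 0\<close> by (metis atLeastAtMost_iff greaterThanAtMost_iff less_eq_real_def)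
    then show False using assms(16) by contradiction
  qed
  have pos: "(\<integral>\<^sup>+ \<rho>. ennreal (- \<Phi> \<rho>) \<partial>lborel) < \<infinity>" "ext_integral lborel \<Phi> > 0"
    using ext_integral_pos[of \<Phi> lborel S H] split S_nonneg intH LH_nonneg strict by simp_all

  \<comment> \<open>Return to the cylinder\<close>
  let ?M = "lebesgue_on (cylinder R L)"
  let ?d = "second_var_density K11 K22 K33 K24 (twist_field R \<beta>) (perturbation R \<beta> f g)"
  have "AE \<rho> in lborel. 0 < \<rho> \<longrightarrow> \<rho> < 1 \<longrightarrow> \<rho> \<in> {0<..<1} - N"
    using AE_lborel_notin_negligible[OF N] by eventually_elim auto
  then have "AE x in ?M. rad x / R \<in> {0<..<1} - N" by (rule AE_cylinder_rad[OF \<open>R > 0\<close>])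
  then have eq: "AE x in ?M. ?d x = D (rad x / R)" by eventually_elim (rule density)
  have "(\<lambda>x. D (rad x / R)) \<in> borel_measurable ?M"
    by (intro measurable_restrict_space1 measurable_completion) simp
  then have meas: "?d \<in> borel_measurable ?M"
    by (rule borel_measurable_lebesgue_on_AE_cong[OF fmeasurableD[OF cylinder_lmeasurable]])
      (use eq in \<open>auto elim: eventually_mono\<close>)
  have "(\<integral>\<^sup>+x. ennreal (?d x) \<partial>?M) = (\<integral>\<^sup>+x. ennreal (D (rad x / R)) \<partial>?M)"
    by (rule nn_integral_cong_AE) (use eq in \<open>auto elim: eventually_mono\<close>)
  also have "\<dots> = (\<integral>\<^sup>+\<rho>. ennreal (\<Phi> \<rho>) \<partial>lborel)"
    using nn_integral_cylinder_rad[OF \<open>R > 0\<close>, of D L] by (simp add: \<Phi>_def C_def)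
  finally have plus: "(\<integral>\<^sup>+x. ennreal (?d x) \<partial>?M) = (\<integral>\<^sup>+\<rho>. ennreal (\<Phi> \<rho>) \<partial>lborel)" .
  have "(\<integral>\<^sup>+x. ennreal (- ?d x) \<partial>?M) = (\<integral>\<^sup>+x. ennreal (- D (rad x / R)) \<partial>?M)"
    by (rule nn_integral_cong_AE) (use eq in \<open>auto elim: eventually_mono\<close>)
  also have "\<dots> = (\<integral>\<^sup>+\<rho>. ennreal (- \<Phi> \<rho>) \<partial>lborel)"
    using nn_integral_cylinder_rad[OF \<open>R > 0\<close>, of "\<lambda>\<rho>. - D \<rho>" L] by (simp add: \<Phi>_def C_def)
  finally have minus: "(\<integral>\<^sup>+x. ennreal (- ?d x) \<partial>?M) = (\<integral>\<^sup>+\<rho>. ennreal (- \<Phi> \<rho>) \<partial>lborel)" .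
  show ?thesis
    using meas pos unfolding quasi_integrable_def second_variation_def ext_integral_def plus minus by simp
qed


end
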